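(* Let $G$ be a $4$-chordal graph that contains a maximal $3$-clique. Then $G$ has a clique transversal with at most $2(|G|-1)/7$ vertices, where $|G|$ is the number of vertices of $G$.
   Context: All graphs are finite and simple. A clique is a complete subgraph; a $k$-clique is a clique on $k$ vertices; a clique is non-trivial if it has at least $2$ vertices and maximal if it is inclusion-wise maximal among complete subgraphs. A graph is chordal if it has no induced cycle of length at least four; a chordal graph is $4$-chordal if every edge lies in a $4$-clique. A clique transversal of $G$ is a set of vertices meeting every non-trivial maximal clique of $G$. *)

theory Defs
  imports Complex_Main "HOL-Library.Ramsey"
begin

definition simple_graph :: "'a set \<Rightarrow> 'a set set \<Rightarrow> bool" where
  "simple_graph V E \<longleftrightarrow> finite V \<and> E \<subseteq> [V]\<^bsup>2\<^esup>"

(* "clique" from HOL-Library.Ramsey takes the vertex set of the complete subgraph as its first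
   argument and does not require it to lie in V: any singleton satisfies it. *)
definition clique_of :: "'a set \<Rightarrow> 'a set set \<Rightarrow> 'a set \<Rightarrow> bool" where
  "clique_of V E K \<longleftrightarrow> K \<subseteq> V \<and> clique K E"

definition k_clique :: "nat \<Rightarrow> 'a set \<Rightarrow> 'a set set \<Rightarrow> 'a set \<Rightarrow> bool" where
  "k_clique k V E K \<longleftrightarrow> clique_of V E K \<and> card K = k"

definition maximal_clique :: "'a set \<Rightarrow> 'a set set \<Rightarrow> 'a set \<Rightarrow> bool" where
  "maximal_clique V E K \<longleftrightarrow>
     clique_of V E K \<and> (\<forall>K'. clique_of V E K' \<longrightarrow> K \<subseteq> K' \<longrightarrow> K' = K)"

definition cycle_edges :: "'a list \<Rightarrow> 'a set set" where
  "cycle_edges vs = {{vs ! i, vs ! (Suc i mod length vs)} | i. i < length vs}"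

definition induced_edges :: "'a set set \<Rightarrow> 'a set \<Rightarrow> 'a set set" where
  "induced_edges E S = {e \<in> E. e \<subseteq> S}"

definition induced_cycle :: "'a set \<Rightarrow> 'a set set \<Rightarrow> 'a list \<Rightarrow> bool" where
  "induced_cycle V E vs \<longleftrightarrow>
     length vs \<ge> 3 \<and> distinct vs \<and> set vs \<subseteq> V \<and> induced_edges E (set vs) = cycle_edges vs"

definition chordal :: "'a set \<Rightarrow> 'a set set \<Rightarrow> bool" where
  "chordal V E \<longleftrightarrow> \<not> (\<exists>vs. induced_cycle V E vs \<and> length vs \<ge> 4)"

definition four_chordal :: "'a set \<Rightarrow> 'a set set \<Rightarrow> bool" where
  "four_chordal V E \<longleftrightarrow> chordal V E \<and> (\<forall>e\<in>E. \<exists>K. k_clique 4 V E K \<and> e \<subseteq> K)"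

definition clique_transversal :: "'a set \<Rightarrow> 'a set set \<Rightarrow> 'a set \<Rightarrow> bool" where
  "clique_transversal V E T \<longleftrightarrow>
     T \<subseteq> V \<and> (\<forall>K. maximal_clique V E K \<and> card K \<ge> 2 \<longrightarrow> T \<inter> K \<noteq> {})"

end

theory Submission
  imports Defs
begin

text \<open>
  Chordal graphs are dismantled by removing simplicial vertices. While doing so we keep a family of
  cliques still to be hit: maximal cliques with at least four vertices, which are free of charge, and demands
  of size 3, 2, 1, which count 2, 3, 5 whereas a vertex counts 2. Each elimination step keeps the
  inequality \<open>7 |T| \<le> 2 |V| + weights\<close>, which settles graphs without maximal triangles.

  A maximal triangle cuts the graph into three pieces, each containing two of its corners. By adding the demands
  \<open>{a, b}\<close>, \<open>{a}\<close> or \<open>{b}\<close> on the two corners \<open>a\<close>, \<open>b\<close> of a piece we control the solutions of that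
  piece that hit prescribed corners, and rounding modulo 7 allows three of them to be glued to a solution
  hitting the triangle as well. For demands within one edge a piece gains one unit, so three pieces gain
  enough to replace \<open>2 |V|\<close> by \<open>2 (|V| - 1)\<close>.
\<close>

text \<open>A four-clique is charged only when one of its simplicial vertices is deleted, and that
  vertex pays for the triple left behind. A maximal triangle has no such spare vertex: deleting a
  corner refunds 2, but leaves a pair of weight 3. This is why triangles are cut out instead of
  being turned into demands. The accounting of a cut: the three pieces share their corners, so their
  sizes add up to |W| + 3 and their budgets to 2|W| + 6 plus weights. Gluing refunds 5. Two pieces
  carry no demands except tests on one edge and gain 1 each, which leaves 2|W| + 6 - 5 - 2 = 2|W| -
  1 plus weights: the gain of one unit reproduces itself. At the outermost triangle no piece carries
  demands, all three gain, and 2|V| + 6 - 5 - 3 = 2(|V| - 1) remains.\<close>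

definition closed_nbhd :: "'a set set \<Rightarrow> 'a set \<Rightarrow> 'a \<Rightarrow> 'a set" where
  "closed_nbhd E W v = {w \<in> W. w = v \<or> {v, w} \<in> E}"

text \<open>The conclusion of Dirac's theorem on chordal graphs, stated so that it passes to subsets of \<open>V\<close>.\<close>

definition dirac :: "'a set set \<Rightarrow> 'a set \<Rightarrow> bool" where
  "dirac E V \<longleftrightarrow> (\<forall>W\<subseteq>V. \<forall>v\<in>W. W \<subseteq> closed_nbhd E W v \<or> (\<exists>u \<in> W - closed_nbhd E W v. clique (closed_nbhd E W u) E))"

lemma clique_mono: "clique K E \<Longrightarrow> K' \<subseteq> K \<Longrightarrow> clique K' E"
  unfolding clique_def by blast

section \<open>Simplicial vertices of chordal graphs\<close>

fun path_edges :: "'a list \<Rightarrow> 'a set set" where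
  "path_edges (a # b # xs) = insert {a, b} (path_edges (b # xs))"
| "path_edges _ = {}"

lemma path_edges_nth: "path_edges xs = {{xs ! i, xs ! Suc i} | i. Suc i < length xs}"
proof (induction xs rule: path_edges.induct)
  case (1 a b xs)
  have "{{(a # b # xs) ! i, (a # b # xs) ! Suc i} | i. Suc i < length (a # b # xs)} =
      insert {a, b} {{(b # xs) ! i, (b # xs) ! Suc i} | i. Suc i < length (b # xs)}" (is "?L = ?R")
  proof (intro equalityI subsetI)
    fix e assume "e \<in> ?L"
    then obtain i where "e = {(a # b # xs) ! i, (a # b # xs) ! Suc i}" "Suc i < length (a # b # xs)" by blast
    then show "e \<in> ?R" by (cases i) auto
  next
    fix e assume "e \<in> ?R"
    then consider "e = {a, b}" | i where "e = {(b # xs) ! i, (b # xs) ! Suc i}" "Suc i < length (b # xs)" by blast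
    then show "e \<in> ?L"
    proof cases
      case 1
      then show ?thesis by (intro CollectI exI[of _ 0]) simp
    next
      case (2 i)
      then show ?thesis by (intro CollectI exI[of _ "Suc i"]) simp
    qed
  qed
  then show ?case using 1 by simp
qed auto

lemma path_edges_subset: "e \<in> path_edges xs \<Longrightarrow> e \<subseteq> set xs"
  by (induction xs rule: path_edges.induct) auto

lemma path_edges_append: "path_edges (xs @ y # ys) = path_edges (xs @ [y]) \<union> path_edges (y # ys)"
  by (induction xs rule: path_edges.induct) auto

lemma path_edges_Cons: "xs \<noteq> [] \<Longrightarrow> path_edges (x # xs) = insert {x, hd xs} (path_edges xs)"
  by (cases xs) auto

lemma path_edges_snoc: "xs \<noteq> [] \<Longrightarrow> path_edges (xs @ [z]) = insert {last xs, z} (path_edges xs)"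
  using path_edges_append[of "butlast xs" "last xs" "[z]"] by (cases xs rule: rev_cases) auto

lemma cycle_edges_path: "xs \<noteq> [] \<Longrightarrow> cycle_edges xs = insert {last xs, hd xs} (path_edges xs)"
proof (intro equalityI subsetI)
  fix e assume "xs \<noteq> []" "e \<in> cycle_edges xs"
  then obtain i where i: "e = {xs ! i, xs ! (Suc i mod length xs)}" "i < length xs"
    unfolding cycle_edges_def by blast
  show "e \<in> insert {last xs, hd xs} (path_edges xs)"
  proof (cases "Suc i = length xs")
    case True
    then have "i = length xs - 1" by simp
    then show ?thesis using i True \<open>xs \<noteq> []\<close> by (simp add: last_conv_nth hd_conv_nth)
  next
    case False
    then have "Suc i < length xs" "e = {xs ! i, xs ! Suc i}" using i by simp_all
    then show ?thesis unfolding path_edges_nth by blast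
  qed
next
  fix e assume xs: "xs \<noteq> []" and "e \<in> insert {last xs, hd xs} (path_edges xs)"
  then consider "e = {last xs, hd xs}" | i where "e = {xs ! i, xs ! Suc i}" "Suc i < length xs"
    unfolding path_edges_nth by blast
  then show "e \<in> cycle_edges xs"
  proof cases
    case 1
    then have "e = {xs ! (length xs - 1), xs ! (Suc (length xs - 1) mod length xs)}"
      using xs by (simp add: last_conv_nth hd_conv_nth)
    moreover have "length xs - 1 < length xs" using xs by simp
    ultimately show ?thesis unfolding cycle_edges_def by blast
  next
    case (2 i)
    then have "e = {xs ! i, xs ! (Suc i mod length xs)}" "i < length xs" by simp_all
    then show ?thesis unfolding cycle_edges_def by blast
  qed
qed

lemma connected_path:
  assumes "(c, d) \<in> {(a, b). a \<in> N \<and> b \<in> N \<and> {a, b} \<in> E}\<^sup>*" "c \<in> N"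
  shows "\<exists>cs. cs \<noteq> [] \<and> set cs \<subseteq> N \<and> path_edges cs \<subseteq> E \<and> hd cs = c \<and> last cs = d"
  using assms(1)
proof (induction rule: rtrancl_induct)
  case base
  then show ?case using assms(2) by (intro exI[of _ "[c]"]) simp
next
  case (step d e)
  then obtain cs where cs: "cs \<noteq> []" "set cs \<subseteq> N" "path_edges cs \<subseteq> E" "hd cs = c" "last cs = d" by blast
  then have "path_edges (cs @ [e]) = insert {d, e} (path_edges cs)" by (simp add: path_edges_snoc)
  then show ?case using cs step(2) by (intro exI[of _ "cs @ [e]"]) auto
qed

text \<open>Take a shortest walk from \<open>s\<close> to \<open>s'\<close> with nonempty interior
  inside \<open>N\<close> and close it through \<open>v\<close>. Shortness rules out repetitions and
  chords on the walk, and \<open>v\<close> sees nothing of \<open>N\<close>, so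
  \<open>{s, s'}\<close> is the only chord that can prevent an induced cycle of length at least
  four.\<close>

lemma chordal_common_neighbours:
  assumes graph: "E \<subseteq> [V]\<^bsup>2\<^esup>" and chordal: "chordal V E"
    and v: "v \<in> V" and N: "N \<subseteq> V" "v \<notin> N" "\<And>c. c \<in> N \<Longrightarrow> {v, c} \<notin> E"
    and s: "{v, s} \<in> E" "{v, s'} \<in> E" "s \<noteq> s'" "s \<notin> N" "s' \<notin> N"
    and c: "c \<in> N" "{s, c} \<in> E" "{c', s'} \<in> E" "(c, c') \<in> {(a, b). a \<in> N \<and> b \<in> N \<and> {a, b} \<in> E}\<^sup>*"
  shows "{s, s'} \<in> E"
proof (rule ccontr)
  assume nonadj: "{s, s'} \<notin> E"
  define walk where "walk cs \<longleftrightarrow> cs \<noteq> [] \<and> set cs \<subseteq> N \<and> path_edges (s # cs @ [s']) \<subseteq> E" for cs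
  have edge: "x \<in> V" "y \<in> V" "x \<noteq> y" if "{x, y} \<in> E" for x y
    using subsetD[OF graph that] unfolding doubleton_in_nsets_2 by auto
  obtain cs0 where cs0: "cs0 \<noteq> []" "set cs0 \<subseteq> N" "path_edges cs0 \<subseteq> E" "hd cs0 = c" "last cs0 = c'"
    using connected_path[OF c(4,1)] by blast
  have "path_edges (s # cs0 @ [s']) = insert {s, c} (insert {c', s'} (path_edges cs0))"
    using cs0(1,4,5) by (simp add: path_edges_Cons path_edges_snoc)
  then have "walk cs0" using cs0 c unfolding walk_def by auto
  then obtain cs where walk: "walk cs" and least: "\<And>ds. walk ds \<Longrightarrow> length cs \<le> length ds"
    using ex_has_least_nat[of walk cs0 length] by blast
  have cs: "cs \<noteq> []" "set cs \<subseteq> N" "path_edges (s # cs @ [s']) \<subseteq> E" using walk by (auto simp: walk_def)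
  have dist: "distinct cs"
  proof (rule ccontr)
    assume "\<not> distinct cs"
    then obtain xs ys zs y where eq: "cs = xs @ [y] @ ys @ [y] @ zs" using not_distinct_decomp by blast
    have "walk (xs @ y # zs)"
      using cs eq path_edges_append[of "s # xs" y "ys @ y # zs @ [s']"]
        path_edges_append[of "y # ys" y "zs @ [s']"] path_edges_append[of "s # xs" y "zs @ [s']"]
      unfolding walk_def by auto
    then show False using least[of "xs @ y # zs"] eq by simp
  qed
  have chord: "e \<in> path_edges cs" if e: "e \<in> E" "e \<subseteq> set cs" for e
  proof -
    have "e \<in> [V]\<^bsup>2\<^esup>" using e(1) graph by blast
    then obtain a b where ab: "e = {a, b}" "a \<noteq> b" by (auto simp: nsets_def card_2_iff)
    \<comment> \<open>If \<open>a\<close> and \<open>b\<close> are adjacent but not consecutive,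
      skipping \<open>ys\<close> gives a shorter walk.\<close>
    have ordered: "{a, b} \<in> path_edges cs" if eq: "cs = xs @ a # ys @ b # zs" and "{a, b} \<in> E" for a b xs ys zs
    proof (cases "ys = []")
      case True
      then show ?thesis using path_edges_append[of xs a "b # zs"] eq by simp
    next
      case False
      have "walk (xs @ a # b # zs)"
        using cs eq path_edges_append[of "s # xs" a "ys @ b # zs @ [s']"]
          path_edges_append[of "a # ys" b "zs @ [s']"] path_edges_append[of "s # xs" a "b # zs @ [s']"]
          \<open>{a, b} \<in> E\<close>
        unfolding walk_def by auto
      then show ?thesis using least[of "xs @ a # b # zs"] eq False by simp
    qed
    obtain xs r where xs: "cs = xs @ a # r" using e(2) ab split_list[of a cs] by auto
    have "b \<in> set xs \<or> b \<in> set r" using e(2) ab xs by auto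
    then show ?thesis
    proof
      assume "b \<in> set xs"
      then obtain ys zs where "xs = ys @ b # zs" using split_list by metis
      then show ?thesis using ordered[of ys b zs a r] xs e(1) ab by (simp add: insert_commute)
    next
      assume "b \<in> set r"
      then obtain ys zs where "r = ys @ b # zs" using split_list by metis
      then show ?thesis using ordered[of xs a ys b zs] xs e(1) ab by simp
    qed
  qed
  have first: "a = hd cs" if a: "a \<in> set cs" and "{s, a} \<in> E" for a
  proof -
    obtain xs zs where eq: "cs = xs @ a # zs" using a split_list by metis
    have "walk (a # zs)"
      using cs eq path_edges_append[of "s # xs" a "zs @ [s']"] \<open>{s, a} \<in> E\<close> unfolding walk_def by auto
    then have "xs = []" using least[of "a # zs"] eq by simp
    then show ?thesis using eq by simp
  qed
  have final: "a = last cs" if a: "a \<in> set cs" and "{a, s'} \<in> E" for a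
  proof -
    obtain xs zs where eq: "cs = xs @ a # zs" using a split_list by metis
    have "walk (xs @ [a])"
      using cs eq path_edges_append[of "s # xs" a "zs @ [s']"]
        path_edges_snoc[of "s # xs @ [a]" s'] \<open>{a, s'} \<in> E\<close> unfolding walk_def by auto
    then have "zs = []" using least[of "xs @ [a]"] eq by simp
    then show ?thesis using eq by simp
  qed
  let ?vs = "v # s # cs @ [s']"
  have vs_edges: "cycle_edges ?vs = {{s', v}, {v, s}, {s, hd cs}, {last cs, s'}} \<union> path_edges cs"
    using cs(1) by (auto simp: cycle_edges_path path_edges_Cons path_edges_snoc)
  have sub: "cycle_edges ?vs \<subseteq> E"
  proof -
    have "cycle_edges ?vs = {{v, s'}, {v, s}} \<union> path_edges (s # cs @ [s'])"
      by (auto simp: cycle_edges_path insert_commute)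
    then show ?thesis using cs(3) s(1,2) by simp
  qed
  have "induced_edges E (set ?vs) = cycle_edges ?vs"
  proof (intro equalityI subsetI)
    fix e assume "e \<in> induced_edges E (set ?vs)"
    then have e: "e \<in> E" "e \<subseteq> set ?vs" by (auto simp: induced_edges_def)
    then have "e \<in> [V]\<^bsup>2\<^esup>" using graph by blast
    then obtain a b where ab: "e = {a, b}" "a \<noteq> b" by (auto simp: nsets_def card_2_iff)
    have special: "{x, y} \<in> cycle_edges ?vs"
      if x: "x = v \<or> x = s \<or> x = s'" and y: "y \<in> set ?vs" and xy: "{x, y} \<in> E" for x y
      using x
    proof (elim disjE)
      assume "x = v"
      then have "y \<noteq> v" "y \<notin> N" using xy edge(3)[OF xy] N(3) by auto
      then have "y = s \<or> y = s'" using y cs(2) by auto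
      then show ?thesis using \<open>x = v\<close> vs_edges by (auto simp: insert_commute)
    next
      assume "x = s"
      then have "y \<noteq> s" "y \<noteq> s'" using xy edge(3)[OF xy] nonadj by auto
      then have "y = v \<or> y = hd cs" using y first[of y] xy \<open>x = s\<close> by auto
      then show ?thesis using \<open>x = s\<close> vs_edges by (auto simp: insert_commute)
    next
      assume "x = s'"
      then have "y \<noteq> s'" "y \<noteq> s" using xy edge(3)[OF xy] nonadj by (auto simp: insert_commute)
      then have "y = v \<or> y = last cs" using y final[of y] xy \<open>x = s'\<close> by (auto simp: insert_commute)
      then show ?thesis using \<open>x = s'\<close> vs_edges by (auto simp: insert_commute)
    qed
    have mem: "a \<in> set ?vs" "b \<in> set ?vs" using e(2) ab(1) by simp_all
    show "e \<in> cycle_edges ?vs"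
    proof (cases "a \<in> set cs \<and> b \<in> set cs")
      case True
      then show ?thesis using chord[OF e(1)] ab(1) vs_edges by simp
    next
      case False
      then consider "a = v \<or> a = s \<or> a = s'" | "b = v \<or> b = s \<or> b = s'" using mem by auto
      then show ?thesis
      proof cases
        case 1
        then show ?thesis using special[OF 1 mem(2)] e(1) ab(1) by simp
      next
        case 2
        have "{b, a} = e" using ab(1) by (rule ssubst) (rule insert_commute)
        then show ?thesis using special[OF 2 mem(1)] e(1) by simp
      qed
    qed
  next
    fix e assume e: "e \<in> cycle_edges ?vs"
    have "hd cs \<in> set cs" "last cs \<in> set cs" using cs(1) by simp_all
    then have "e \<subseteq> set ?vs" using e path_edges_subset[of e cs] unfolding vs_edges by auto
    then show "e \<in> induced_edges E (set ?vs)" using e sub by (auto simp: induced_edges_def)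
  qed
  moreover have "distinct ?vs" using dist cs(2) s(3-5) N(2) edge[OF s(1)] edge[OF s(2)] by auto
  moreover have "set ?vs \<subseteq> V" using cs(2) N(1) v edge[OF s(1)] edge[OF s(2)] by auto
  ultimately have "induced_cycle V E ?vs \<and> 4 \<le> length ?vs"
    using cs(1) by (cases cs) (auto simp: induced_cycle_def)
  then show False using chordal unfolding chordal_def by blast
qed

text \<open>Let \<open>C\<close> be a component of the non-neighbours of \<open>v\<close> and
  \<open>S\<close> its attachment among the neighbours of \<open>v\<close>, a clique by the previous
  lemma. Within \<open>W\<close> a vertex of \<open>C\<close> has all its neighbours in the union of
  \<open>C\<close> and \<open>S\<close>, so it is simplicial in \<open>W\<close> as soon as it is
  simplicial there; induction applies since \<open>v\<close> is missing from that union.\<close>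

lemma chordal_dirac:
  assumes graph: "simple_graph V E" and chordal: "chordal V E"
  shows "dirac E V"
proof -
  have fin: "finite V" and E: "E \<subseteq> [V]\<^bsup>2\<^esup>" using graph by (auto simp: simple_graph_def)
  have "\<exists>u \<in> W - closed_nbhd E W v. clique (closed_nbhd E W u) E"
    if "W \<subseteq> V" "v \<in> W" "\<not> W \<subseteq> closed_nbhd E W v" for W v
    using that
  proof (induction "card W" arbitrary: W v rule: less_induct)
    case less
    define N where "N = W - closed_nbhd E W v"
    obtain c0 where c0: "c0 \<in> N" using less.prems(3) unfolding N_def by blast
    define R where "R = {(a, b). a \<in> N \<and> b \<in> N \<and> {a, b} \<in> E}"
    define C where "C = R\<^sup>* `` {c0}"
    define S where "S = {s \<in> closed_nbhd E W v. \<exists>c\<in>C. {s, c} \<in> E}"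
    have "c \<in> N" if "(c0, c) \<in> R\<^sup>*" for c
      using that c0 by (induction rule: rtrancl_induct) (auto simp: R_def)
    then have CN: "C \<subseteq> N" by (auto simp: C_def)
    have c0C: "c0 \<in> C" by (simp add: C_def)
    have "sym R" unfolding R_def by (auto simp: sym_def insert_commute)
    then have symR: "sym (R\<^sup>*)" by (rule sym_rtrancl)
    have nonadj: "{v, c} \<notin> E" if "c \<in> N" for c using that by (simp add: N_def closed_nbhd_def)
    have vN: "v \<notin> N" using less.prems(2) by (simp add: N_def closed_nbhd_def)
    have NV: "N \<subseteq> V" using less.prems(1) by (auto simp: N_def)
    have S: "s \<in> W" "{v, s} \<in> E" "s \<notin> N" if s: "s \<in> S" for s
    proof -
      show "s \<in> W" "s \<notin> N" using s by (auto simp: S_def N_def closed_nbhd_def)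
      obtain c where "c \<in> N" "{s, c} \<in> E" using s CN by (auto simp: S_def)
      then have "s \<noteq> v" using nonadj by auto
      then show "{v, s} \<in> E" using s by (auto simp: S_def closed_nbhd_def)
    qed
    have cliqueS: "clique S E" unfolding clique_def
    proof (intro ballI impI)
      fix s s' assume s: "s \<in> S" "s' \<in> S" "s \<noteq> s'"
      obtain c c' where c: "c \<in> C" "{s, c} \<in> E" "c' \<in> C" "{s', c'} \<in> E" using s(1,2) by (auto simp: S_def)
      have "(c0, c) \<in> R\<^sup>*" "(c0, c') \<in> R\<^sup>*" using c by (auto simp: C_def)
      then have path: "(c, c') \<in> R\<^sup>*" using symR by (meson rtrancl_trans symD)
      have vV: "v \<in> V" using less.prems(1,2) by auto
      have "c \<in> N" "{c', s'} \<in> E" using c CN by (auto simp: insert_commute)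
      then show "{s, s'} \<in> E"
        using chordal_common_neighbours[OF E chordal vV NV vN nonadj S(2)[OF s(1)] S(2)[OF s(2)]
            s(3) S(3)[OF s(1)] S(3)[OF s(2)]] c(2) path unfolding R_def by blast
    qed
    let ?W = "C \<union> S"
    have sub: "?W \<subseteq> W" using CN S(1) by (auto simp: N_def)
    have "v \<notin> ?W" using CN vN S(2) nonadj E by (auto simp: S_def)
    then have "?W \<subset> W" using sub less.prems(2) by blast
    then have lt: "card ?W < card W" using finite_subset[OF less.prems(1) fin] by (rule psubset_card_mono[rotated])
    have WV: "?W \<subseteq> V" using sub less.prems(1) by blast
    have nbC: "closed_nbhd E W u \<subseteq> closed_nbhd E ?W u" if "u \<in> C" for u
    proof
      fix w assume w: "w \<in> closed_nbhd E W u"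
      show "w \<in> closed_nbhd E ?W u"
      proof (cases "w = u")
        case False
        then have e: "{u, w} \<in> E" "w \<in> W" using w by (auto simp: closed_nbhd_def)
        have "w \<in> ?W"
        proof (cases "w \<in> N")
          case True
          then have "(u, w) \<in> R" using e that CN by (auto simp: R_def)
          then show ?thesis using that by (auto simp: C_def)
        next
          case False
          then have "w \<in> closed_nbhd E W v" using e(2) by (simp add: N_def)
          moreover have "{w, u} \<in> E" using e(1) by (simp add: insert_commute)
          ultimately show ?thesis using that by (auto simp: S_def)
        qed
        then show ?thesis using e by (simp add: closed_nbhd_def)
      qed (use that in \<open>simp add: closed_nbhd_def\<close>)
    qed
    have "\<exists>u\<in>C. clique (closed_nbhd E ?W u) E"
    proof (cases "\<forall>x\<in>?W. ?W \<subseteq> closed_nbhd E ?W x")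
      case True
      have "clique ?W E" unfolding clique_def
      proof (intro ballI impI)
        fix x y assume "x \<in> ?W" "y \<in> ?W" "x \<noteq> y"
        then have "y \<in> closed_nbhd E ?W x" using True by auto
        then show "{x, y} \<in> E" using \<open>x \<noteq> y\<close> by (simp add: closed_nbhd_def)
      qed
      then have "clique (closed_nbhd E ?W c0) E" by (rule clique_mono) (auto simp: closed_nbhd_def)
      then show ?thesis using c0C by blast
    next
      case False
      \<comment> \<open>Preferring \<open>x\<close> in \<open>S\<close> forces the vertex
        \<open>u\<close> given by induction into \<open>C\<close>. If \<open>x\<close> is in
        \<open>S\<close>, it sees all of the clique \<open>S\<close>; otherwise every vertex of
        \<open>S\<close> dominates and sees \<open>x\<close>. Either way the non-neighbour
        \<open>u\<close> of \<open>x\<close> is not in \<open>S\<close>.\<close>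
      then obtain x where x: "x \<in> ?W" "\<not> ?W \<subseteq> closed_nbhd E ?W x"
        and xS: "x \<in> S \<or> (\<forall>y\<in>S. ?W \<subseteq> closed_nbhd E ?W y)" by blast
      obtain u where u: "u \<in> ?W" "u \<notin> closed_nbhd E ?W x" "clique (closed_nbhd E ?W u) E"
        using less.hyps[OF lt WV x] by blast
      have "u \<notin> S"
      proof
        assume "u \<in> S"
        have "u \<noteq> x" using u(1,2) by (auto simp: closed_nbhd_def)
        from xS show False
        proof
          assume "x \<in> S"
          then have "{x, u} \<in> E" using cliqueS \<open>u \<in> S\<close> \<open>u \<noteq> x\<close> by (auto simp: clique_def)
          then show False using u(1,2) by (simp add: closed_nbhd_def)
        next
          assume "\<forall>y\<in>S. ?W \<subseteq> closed_nbhd E ?W y"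
          then have "x \<in> closed_nbhd E ?W u" using \<open>u \<in> S\<close> x(1) by blast
          then have "{x, u} \<in> E" using \<open>u \<noteq> x\<close> by (simp add: closed_nbhd_def insert_commute)
          then show False using u(1,2) by (simp add: closed_nbhd_def)
        qed
      qed
      then show ?thesis using u by blast
    qed
    then obtain u where u: "u \<in> C" "clique (closed_nbhd E ?W u) E" by blast
    then have "clique (closed_nbhd E W u) E" using clique_mono nbC by blast
    then show ?case using u(1) CN unfolding N_def by blast
  qed
  then show ?thesis unfolding dirac_def by blast
qed

section \<open>Finding simplicial vertices from the Dirac property\<close>

lemma clique_subset_closed_nbhd: "clique K E \<Longrightarrow> K \<subseteq> V \<Longrightarrow> u \<in> K \<Longrightarrow> K \<subseteq> closed_nbhd E V u"
  unfolding clique_def closed_nbhd_def by auto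

lemma simplicial_subset:
  "clique (closed_nbhd E V u) E \<Longrightarrow> W \<subseteq> V \<Longrightarrow> clique (closed_nbhd E W u) E"
  by (erule clique_mono) (auto simp: closed_nbhd_def)

lemma dirac_subset: "dirac E V \<Longrightarrow> W \<subseteq> V \<Longrightarrow> dirac E W"
  unfolding dirac_def by blast

lemma dirac_simplicial:
  assumes "dirac E V" "W \<subseteq> V" "W \<noteq> {}"
  obtains u where "u \<in> W" "clique (closed_nbhd E W u) E"
proof (cases "\<forall>v\<in>W. W \<subseteq> closed_nbhd E W v")
  case True
  have "clique W E" unfolding clique_def
  proof (intro ballI impI)
    fix v w assume "v \<in> W" "w \<in> W" "v \<noteq> w"
    then have "w \<in> closed_nbhd E W v" using True by auto
    then show "{v, w} \<in> E" using \<open>v \<noteq> w\<close> by (simp add: closed_nbhd_def)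
  qed
  moreover obtain u where "u \<in> W" using assms(3) by auto
  moreover have "closed_nbhd E W u \<subseteq> W" by (auto simp: closed_nbhd_def)
  ultimately show ?thesis using that[of u] clique_mono[of W E "closed_nbhd E W u"] by simp
next
  case False
  then obtain v where v: "v \<in> W" "\<not> W \<subseteq> closed_nbhd E W v" by auto
  then have "\<exists>u \<in> W - closed_nbhd E W v. clique (closed_nbhd E W u) E"
    using assms(1)[unfolded dirac_def, rule_format, OF assms(2) v(1)] by simp
  then show ?thesis using that by auto
qed

text \<open>A simplicial non-neighbour of \<open>a\<close> differs from \<open>a\<close> and from
  its neighbour \<open>b\<close>, and likewise with \<open>a\<close> and \<open>b\<close> exchanged.
  If both dominate \<open>V\<close>, a vertex simplicial in the rest stays simplicial when they are
  put back.\<close>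

lemma dirac_simplicial_avoiding:
  assumes "dirac E V" "{a, b} \<in> E" "a \<in> V" "b \<in> V" "V \<noteq> {a, b}"
  obtains p where "p \<in> V" "clique (closed_nbhd E V p) E" "p \<noteq> a" "p \<noteq> b"
proof (cases "V \<subseteq> closed_nbhd E V a \<and> V \<subseteq> closed_nbhd E V b")
  case False
  then consider "\<not> V \<subseteq> closed_nbhd E V a" | "\<not> V \<subseteq> closed_nbhd E V b" by auto
  then show ?thesis
  proof cases
    case 1
    then obtain p where "p \<in> V" "p \<notin> closed_nbhd E V a" "clique (closed_nbhd E V p) E"
      using assms(1)[unfolded dirac_def, rule_format, OF subset_refl assms(3)] by auto
    then show ?thesis using that[of p] assms(2-4) by (auto simp: closed_nbhd_def)
  next
    case 2
    then obtain p where "p \<in> V" "p \<notin> closed_nbhd E V b" "clique (closed_nbhd E V p) E"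
      using assms(1)[unfolded dirac_def, rule_format, OF subset_refl assms(4)] by auto
    moreover from this have "p \<noteq> a" "p \<noteq> b"
      using assms(2-4) by (auto simp: closed_nbhd_def insert_commute)
    ultimately show ?thesis using that by blast
  qed
next
  case True
  have ne: "V - {a, b} \<noteq> {}" using assms(3-5) by auto
  obtain p where p: "p \<in> V - {a, b}" "clique (closed_nbhd E (V - {a, b}) p) E"
    using dirac_simplicial[OF assms(1) _ ne] by auto
  have "{v, w} \<in> E" if "v \<in> closed_nbhd E V p" "w \<in> closed_nbhd E V p" "v \<noteq> w" for v w
  proof -
    have vw: "v \<in> V" "w \<in> V" using that by (auto simp: closed_nbhd_def)
    consider "v = a" | "v = b" | "w = a" | "w = b" | "v \<notin> {a, b}" "w \<notin> {a, b}" by auto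
    then show ?thesis
    proof cases
      case 5
      then have "v \<in> closed_nbhd E (V - {a, b}) p" "w \<in> closed_nbhd E (V - {a, b}) p" using that by (auto simp: closed_nbhd_def)
      then show ?thesis using p(2) \<open>v \<noteq> w\<close> by (auto simp: clique_def)
    qed (use True vw \<open>v \<noteq> w\<close> in \<open>auto simp: closed_nbhd_def insert_commute\<close>)
  qed
  then have "clique (closed_nbhd E V p) E" by (auto simp: clique_def)
  then show ?thesis using that[of p] p(1) by auto
qed

section \<open>Hitting weighted demands\<close>

definition hits :: "'a set \<Rightarrow> 'a set set \<Rightarrow> bool" where
  "hits T F \<longleftrightarrow> (\<forall>A\<in>F. T \<inter> A \<noteq> {})"

text \<open>
  A demand is a clique of at most three vertices that has to be hit. A three-element demand stands for a
  maximal four-clique with one private vertex, hence weighs as much as one vertex, that is 2. The weight of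
  pairs is the least one for which a vertex lying in a pair and a triple, or forming a pair with a
  vertex in no other demand, is worth taking: 2 + 3 + 2 = 7. Likewise 2 + 5 = 7 for singletons.
\<close>

definition wt :: "'a set \<Rightarrow> nat" where
  "wt A = (if card A = 1 then 5 else if card A = 2 then 3 else 2)"

text \<open>Maximality in the current \<open>V\<close> makes the closed neighbourhood of a
  simplicial vertex the only member of \<open>L\<close> that can contain it. Having at least four
  vertices, such a member still contains a triple once that vertex is gone.\<close>

definition demands :: "'a set set \<Rightarrow> 'a set \<Rightarrow> 'a set set \<Rightarrow> 'a set set \<Rightarrow> bool" where
  "demands E V L X \<longleftrightarrow> (\<forall>K\<in>L. maximal_clique V E K \<and> 4 \<le> card K) \<and>
     finite X \<and> (\<forall>A\<in>X. A \<subseteq> V \<and> clique A E \<and> card A \<in> {1, 2, 3})"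

lemma maximal_clique_subset:
  "maximal_clique V E K \<Longrightarrow> K \<subseteq> W \<Longrightarrow> W \<subseteq> V \<Longrightarrow> maximal_clique W E K"
  unfolding maximal_clique_def clique_of_def by blast

lemma maximal_clique_simplicial:
  assumes "clique (closed_nbhd E V u) E" "maximal_clique V E K" "u \<in> K"
  shows "K = closed_nbhd E V u"
proof -
  have "K \<subseteq> closed_nbhd E V u"
    using assms(2,3) unfolding maximal_clique_def clique_of_def by (intro clique_subset_closed_nbhd) auto
  moreover have "clique_of V E (closed_nbhd E V u)"
    using assms(1) by (simp add: clique_of_def closed_nbhd_def)
  ultimately show ?thesis using assms(2) unfolding maximal_clique_def by auto
qed

lemma demands_remove:
  assumes "demands E V L X" "W \<subseteq> V"
  shows "demands E W {K \<in> L. K \<subseteq> W} {A \<in> X. A \<subseteq> W}"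
  using assms(1) maximal_clique_subset[OF _ _ assms(2)] unfolding demands_def by simp

text \<open>Every clique to be hit that meets \<open>U\<close> contains \<open>v\<close>, so once
  \<open>v\<close> is chosen all of \<open>U\<close> can be deleted and the other cliques survive
  intact. The 7 units for \<open>v\<close> come from 2 per vertex of \<open>U\<close> and from the
  demands through \<open>v\<close>.\<close>

lemma take_vertex:
  assumes fin: "finite V" and dem: "demands E V L X"
    and U: "U \<subseteq> V" "v \<in> U" "\<And>A. A \<in> L \<union> X \<Longrightarrow> A \<inter> U \<noteq> {} \<Longrightarrow> v \<in> A"
    and w: "7 \<le> 2 * card U + sum wt {A \<in> X. v \<in> A}"
  shows "\<exists>L' X'. demands E (V - U) L' X' \<and> X' \<subseteq> X \<and>
      7 + 2 * card (V - U) + sum wt X' \<le> 2 * card V + sum wt X \<and>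
      (\<forall>T. hits T L' \<longrightarrow> hits T X' \<longrightarrow> hits (insert v T) (L \<union> X))"
proof (intro exI conjI)
  let ?L = "{K \<in> L. K \<subseteq> V - U}" and ?X = "{A \<in> X. A \<subseteq> V - U}"
  show "demands E (V - U) ?L ?X" by (rule demands_remove[OF dem]) auto
  show "?X \<subseteq> X" by auto
  have finX: "finite X" and sub: "\<And>A. A \<in> L \<union> X \<Longrightarrow> A \<subseteq> V"
    using dem unfolding demands_def maximal_clique_def clique_of_def by auto
  have "sum wt ?X + sum wt {A \<in> X. v \<in> A} = sum wt (?X \<union> {A \<in> X. v \<in> A})"
    by (rule sum.union_disjoint[symmetric]) (use finX U in auto)
  also have "\<dots> \<le> sum wt X" by (rule sum_mono2) (use finX in auto)
  finally have "sum wt ?X + sum wt {A \<in> X. v \<in> A} \<le> sum wt X" .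
  moreover have "card (V - U) + card U = card V"
    using fin U(1) by (metis card_Diff_subset card_mono finite_subset le_add_diff_inverse2)
  ultimately show "7 + 2 * card (V - U) + sum wt ?X \<le> 2 * card V + sum wt X"
    using w by linarith
  have split: "v \<in> A \<or> A \<subseteq> V - U" if "A \<in> L \<union> X" for A
    using U(3)[OF that] sub[OF that] by blast
  show "\<forall>T. hits T ?L \<longrightarrow> hits T ?X \<longrightarrow> hits (insert v T) (L \<union> X)"
  proof (intro allI impI)
    fix T assume T: "hits T ?L" "hits T ?X"
    have "insert v T \<inter> A \<noteq> {}" if "A \<in> L \<union> X" for A
      using split[OF that] that T unfolding hits_def by (cases "v \<in> A") auto
    then show "hits (insert v T) (L \<union> X)" by (simp add: hits_def)
  qed
qed

text \<open>The closed neighbourhood of \<open>u\<close> is the only member of \<open>L\<close>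
  lost. Whoever applies this has to choose \<open>X'\<close> so that the lost clique is hit
  nevertheless.\<close>

lemma demands_delete:
  assumes "demands E V L X" "clique (closed_nbhd E V u) E" "finite X'"
    and "\<And>A. A \<in> X' \<Longrightarrow> A \<subseteq> V - {u} \<and> clique A E \<and> card A \<in> {1, 2, 3}"
  shows "demands E (V - {u}) (L - {closed_nbhd E V u}) X'"
  unfolding demands_def
proof (intro conjI ballI)
  fix K assume K: "K \<in> L - {closed_nbhd E V u}"
  then have max: "maximal_clique V E K" "4 \<le> card K" using assms(1) unfolding demands_def by auto
  then show "4 \<le> card K" by simp
  have "u \<notin> K" using K max(1) maximal_clique_simplicial[OF assms(2)] by blast
  moreover have "K \<subseteq> V" using max(1) unfolding maximal_clique_def clique_of_def by blast
  ultimately show "maximal_clique (V - {u}) E K"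
    by (intro maximal_clique_subset[OF max(1)]) auto
qed (use assms in auto)

lemma sum_card_bound:
  assumes "finite X" "\<And>A. A \<in> X \<Longrightarrow> (2::nat) \<le> f A" "sum f X \<le> 4"
  shows "card X \<le> 2"
proof -
  have "2 * card X \<le> sum f X" using sum_bounded_below[of X 2 f] assms by simp
  then show ?thesis using assms(3) by linarith
qed

text \<open>
  A vertex whose demands weigh at least 5 pays for itself. Otherwise the simplicial vertex \<open>u\<close> lies in
  no demand, in one or two triples, or in a single pair. In the first case \<open>u\<close> is traded for a triple of
  its clique; in the second, removing \<open>u\<close> gains 2 while each triple shrinks to a pair at cost 1; in the
  third the other end of the pair is taken and \<open>u\<close> is discarded.
\<close>

lemma elimination_step:
  assumes fin: "finite V" and dem: "demands E V L X"
    and u: "u \<in> V" and simp: "clique (closed_nbhd E V u) E"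
  shows "\<exists>V' L' X' D. V' \<subset> V \<and> V - V' \<subseteq> insert u (\<Union>X) \<and> demands E V' L' X' \<and>
      \<Union>X' \<subseteq> \<Union>X \<union> closed_nbhd E V u \<and> D \<subseteq> V \<and>
      7 * card D + 2 * card V' + sum wt X' \<le> 2 * card V + sum wt X \<and>
      (\<forall>T. hits T L' \<longrightarrow> hits T X' \<longrightarrow> hits (T \<union> D) (L \<union> X))"
proof -
  have finX: "finite X" and X: "\<And>A. A \<in> X \<Longrightarrow> A \<subseteq> V \<and> clique A E \<and> card A \<in> {1, 2, 3}"
    and L: "\<And>K. K \<in> L \<Longrightarrow> maximal_clique V E K \<and> 4 \<le> card K"
    using dem unfolding demands_def by auto
  let ?S = "{A \<in> X. u \<in> A}" and ?Q = "closed_nbhd E V u"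
  have uQ: "u \<in> ?Q" using u by (simp add: closed_nbhd_def)
  have SQ: "A \<subseteq> ?Q" if "A \<in> ?S" for A
    using that X[of A] clique_subset_closed_nbhd[of A E V u] by simp
  have LQ: "K = ?Q" if "K \<in> L" "u \<in> K" for K
    using that L[of K] maximal_clique_simplicial[OF simp, of K] by simp
  have take: ?thesis
    if v: "v \<in> U" "v \<in> \<Union>X" and U: "U \<subseteq> insert u (\<Union>X)" "U \<subseteq> V"
      "\<And>A. A \<in> L \<union> X \<Longrightarrow> A \<inter> U \<noteq> {} \<Longrightarrow> v \<in> A"
      "7 \<le> 2 * card U + sum wt {A \<in> X. v \<in> A}" for v U
  proof -
    obtain L' X' where "demands E (V - U) L' X'" "X' \<subseteq> X"
      "7 + 2 * card (V - U) + sum wt X' \<le> 2 * card V + sum wt X"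
      "\<forall>T. hits T L' \<longrightarrow> hits T X' \<longrightarrow> hits (insert v T) (L \<union> X)"
      using take_vertex[OF fin dem U(2) v(1) U(3,4)] by blast
    note new = this
    show ?thesis
    proof (rule exI[of _ "V - U"], rule exI[of _ L'], rule exI[of _ X'], rule exI[of _ "{v}"], intro conjI)
      show "V - U \<subset> V" using v U by blast
      \<comment> \<open>Only \<open>u\<close> and vertices of demands are deleted, and new demands
        stay inside old ones and the clique of \<open>u\<close>. The rooted version relies on this
        locality to keep its vertex \<open>p\<close> alive and outside all demands.\<close>
      show "V - (V - U) \<subseteq> insert u (\<Union>X)" using U by blast
      show "\<Union>X' \<subseteq> \<Union>X \<union> closed_nbhd E V u" using new(2) by blast
      show "\<forall>T. hits T L' \<longrightarrow> hits T X' \<longrightarrow> hits (T \<union> {v}) (L \<union> X)" using new(4) by simp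
      show "{v} \<subseteq> V" using v U by blast
    qed (use new in simp_all)
  qed
  consider (heavy) v where "v \<in> \<Union>X" "5 \<le> sum wt {A \<in> X. v \<in> A}"
    | (free) "?S = {}"
    | (pair) B where "B \<in> ?S" "card B = 2" "sum wt ?S \<le> 4"
    | (triples) "sum wt ?S \<le> 4" "?S \<noteq> {}" "\<And>A. A \<in> ?S \<Longrightarrow> card A = 3"
  proof (cases "sum wt ?S \<le> 4")
    case True
    have "card A \<noteq> 1" if "A \<in> ?S" for A
    proof
      assume "card A = 1"
      then have "wt A = 5" by (simp add: wt_def)
      moreover have "wt A \<le> sum wt ?S" by (rule member_le_sum) (use that finX in auto)
      ultimately show False using True by simp
    qed
    then have "card A \<in> {2,3}" if "A \<in> ?S" for A using that X by blast
    then show ?thesis using that(2-4) True by blast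
  next
    case False
    then have "?S \<noteq> {}" by (metis sum.empty le0)
    then show ?thesis using that(1)[of u] False by auto
  qed
  then show ?thesis
  proof cases
    case (heavy v)
    show ?thesis
    proof (rule take[of v "{v}"])
      show "{v} \<subseteq> V" using heavy(1) X by blast
    qed (use heavy in auto)
  next
    case (pair B)
    then obtain a b where "B = {a, b}" "a \<noteq> b" "u = a \<or> u = b" "B \<in> X"
      by (auto simp: card_2_iff)
    then obtain v where B: "B = {u, v}" "v \<noteq> u" "B \<in> X"
      by (metis insert_commute)
    have only: "A = B" if "A \<in> ?S" for A
    proof (rule ccontr)
      assume "A \<noteq> B"
      then have "sum wt {A, B} \<le> sum wt ?S"
        by (intro sum_mono2) (use that pair finX in auto)
      moreover have "wt B = 3" "wt A \<ge> 2" using pair by (auto simp: wt_def)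
      ultimately show False using \<open>A \<noteq> B\<close> pair by simp
    qed
    have vQ: "v \<in> ?Q" using SQ[of B] pair(1) B(1) by simp
    have "wt B \<le> sum wt {A \<in> X. v \<in> A}"
      by (rule member_le_sum) (use B finX in auto)
    moreover have "wt B = 3" using pair by (simp add: wt_def)
    ultimately have w: "7 \<le> 2 * card {u, v} + sum wt {A \<in> X. v \<in> A}" using B by simp
    show ?thesis
    proof (rule take[of v "{u, v}"])
      show "{u, v} \<subseteq> V" using u B X[of B] by simp
    next
      fix A assume A: "A \<in> L \<union> X" "A \<inter> {u, v} \<noteq> {}"
      show "v \<in> A"
      proof (cases "u \<in> A")
        case True
        then have "A = ?Q \<or> A = B" using A(1) LQ[of A] only[of A] by auto
        then show ?thesis using vQ B(1) by auto
      qed (use A in auto)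
    qed (use w B in auto)
  next
    case free
    show ?thesis
    \<comment> \<open>A demand inside the clique of \<open>u\<close> already forces that clique to
      be hit, so a new triple is paid for only if there is none.\<close>
    proof (cases "?Q \<in> L \<and> (\<forall>A\<in>X. \<not> A \<subseteq> ?Q)")
      case True
      then have "3 \<le> card (?Q - {u})" using L[of ?Q] uQ by auto
      then obtain A where A: "A \<subseteq> ?Q - {u}" "card A = 3"
        by (metis obtain_subset_with_card_n)
      show ?thesis
      proof (rule exI[of _ "V - {u}"], rule exI[of _ "L - {?Q}"], rule exI[of _ "insert A X"], rule exI[of _ "{}"], intro conjI)
        have "A \<subseteq> V - {u} \<and> clique A E" using A clique_mono[OF simp, of A] by (auto simp: closed_nbhd_def)
        then show "demands E (V - {u}) (L - {?Q}) (insert A X)"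
          using A X finX free by (intro demands_delete[OF dem simp]) auto
        have "sum wt (insert A X) \<le> wt A + sum wt X"
          using finX by (cases "A \<in> X") (auto simp: insert_absorb)
        moreover have "wt A = 2" using A by (simp add: wt_def)
        moreover have "card V = Suc (card (V - {u}))" using u fin by (metis card.remove)
        ultimately show "7 * card {} + 2 * card (V - {u}) + sum wt (insert A X) \<le> 2 * card V + sum wt X"
          by simp
        show "\<forall>T. hits T (L - {?Q}) \<longrightarrow> hits T (insert A X) \<longrightarrow> hits (T \<union> {}) (L \<union> X)"
        proof (intro allI impI)
          fix T assume T: "hits T (L - {?Q})" "hits T (insert A X)"
          have "T \<inter> A \<noteq> {}" using T(2) by (simp add: hits_def)
          then have "T \<inter> ?Q \<noteq> {}" using A(1) by auto
          then show "hits (T \<union> {}) (L \<union> X)" using T unfolding hits_def by auto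
        qed
      qed (use A u in auto)
    next
      case False
      show ?thesis
      proof (rule exI[of _ "V - {u}"], rule exI[of _ "L - {?Q}"], rule exI[of _ X], rule exI[of _ "{}"], intro conjI)
        show "demands E (V - {u}) (L - {?Q}) X"
          using X finX free by (intro demands_delete[OF dem simp]) auto
        show "7 * card {} + 2 * card (V - {u}) + sum wt X \<le> 2 * card V + sum wt X"
          using fin by (simp add: card_mono)
        show "\<forall>T. hits T (L - {?Q}) \<longrightarrow> hits T X \<longrightarrow> hits (T \<union> {}) (L \<union> X)"
        proof (intro allI impI)
          fix T assume T: "hits T (L - {?Q})" "hits T X"
          have "T \<inter> ?Q \<noteq> {}" if live: "?Q \<in> L"
          proof -
            obtain A where "A \<in> X" "A \<subseteq> ?Q" using False live by auto
            moreover have "T \<inter> A \<noteq> {}" using T(2) \<open>A \<in> X\<close> by (simp add: hits_def)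
            ultimately show ?thesis by auto
          qed
          then show "hits (T \<union> {}) (L \<union> X)" using T unfolding hits_def by auto
        qed
      qed (use u in auto)
    qed
  next
    case triples
    let ?R = "(\<lambda>A. A - {u}) ` ?S"
    have finS: "finite ?S" using finX by simp
    have card_R: "card A = 2" if "A \<in> ?R" for A
      using that triples(3) by auto
    have "card ?S \<le> 2"
      by (rule sum_card_bound[OF finS]) (use triples in \<open>auto simp: wt_def\<close>)
    have "sum wt ((X - ?S) \<union> ?R) \<le> sum wt (X - ?S) + sum wt ?R"
      using finX by (intro sum_Un_nat[THEN eq_refl, THEN order_trans]) auto
    also have "sum wt ?R = 3 * card ?R" using card_R by (simp add: wt_def)
    also have "3 * card ?R \<le> 3 * card ?S" using card_image_le[OF finS] by simp
    also have "3 * card ?S \<le> 2 + 2 * card ?S" using \<open>card ?S \<le> 2\<close> by simp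
    also have "2 * card ?S = sum wt ?S" using triples(3) by (simp add: wt_def)
    also have "sum wt (X - ?S) + (2 + sum wt ?S) = 2 + sum wt X"
      using sum.subset_diff[of ?S X wt] finX by auto
    finally have w: "sum wt ((X - ?S) \<union> ?R) \<le> 2 + sum wt X" by simp
    show ?thesis
    proof (rule exI[of _ "V - {u}"], rule exI[of _ "L - {?Q}"], rule exI[of _ "(X - ?S) \<union> ?R"], rule exI[of _ "{}"], intro conjI)
      show "demands E (V - {u}) (L - {?Q}) ((X - ?S) \<union> ?R)"
      proof (rule demands_delete[OF dem simp])
        fix A assume A: "A \<in> (X - ?S) \<union> ?R"
        then obtain B where "B \<in> X" "A \<subseteq> B" "u \<notin> A" by auto
        then have "A \<subseteq> V - {u}" "clique A E" using X[of B] clique_mono[of B E A] by auto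
        moreover have "card A \<in> {1, 2, 3}" using A X card_R by blast
        ultimately show "A \<subseteq> V - {u} \<and> clique A E \<and> card A \<in> {1, 2, 3}" by simp
      qed (use finX in auto)
      show "7 * card {} + 2 * card (V - {u}) + sum wt ((X - ?S) \<union> ?R) \<le> 2 * card V + sum wt X"
        using w card.remove[OF fin u] by simp
      show "\<forall>T. hits T (L - {?Q}) \<longrightarrow> hits T ((X - ?S) \<union> ?R) \<longrightarrow> hits (T \<union> {}) (L \<union> X)"
      proof (intro allI impI)
        fix T assume T: "hits T (L - {?Q})" "hits T ((X - ?S) \<union> ?R)"
        have S: "T \<inter> A \<noteq> {}" if "A \<in> ?S" for A
        proof -
          have "T \<inter> (A - {u}) \<noteq> {}" using T(2) that unfolding hits_def by auto
          then show ?thesis by blast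
        qed
        obtain B where "B \<in> ?S" using triples(2) by blast
        then have "T \<inter> ?Q \<noteq> {}" using S[of B] SQ[of B] by auto
        moreover have "T \<inter> A \<noteq> {}" if "A \<in> L - {?Q}" for A
          using T(1) that by (simp add: hits_def)
        moreover have "T \<inter> A \<noteq> {}" if "A \<in> X - ?S" for A
          using T(2) that by (simp add: hits_def)
        ultimately have "T \<inter> A \<noteq> {}" if "A \<in> L \<union> X" for A
          using S[of A] that by (metis (no_types, lifting) DiffI UnE singletonD)
        then show "hits (T \<union> {}) (L \<union> X)" by (simp add: hits_def)
      qed
      show "\<Union> (X - ?S \<union> ?R) \<subseteq> \<Union> X \<union> closed_nbhd E V u" by auto
    qed (use u in auto)
  qed
qed

section \<open>Transversals by repeated elimination\<close>

lemma weighted_transversal: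
  assumes "finite V" "dirac E V" "demands E V L X"
  shows "\<exists>T\<subseteq>V. hits T (L \<union> X) \<and> 7 * card T \<le> 2 * card V + sum wt X"
  using assms
proof (induction "card V" arbitrary: V L X rule: less_induct)
  case less
  show ?case
  proof (cases "V = {}")
    case True
    then have "L = {}" "X = {}"
      using less.prems(3) unfolding demands_def maximal_clique_def clique_of_def by fastforce+
    then show ?thesis by (intro exI[of _ "{}"]) (simp add: hits_def)
  next
    case False
    obtain u where u: "u \<in> V" "clique (closed_nbhd E V u) E"
      using dirac_simplicial[OF less.prems(2) subset_refl False] .
    obtain V' L' X' D where step: "V' \<subset> V" "demands E V' L' X'" "D \<subseteq> V"
      "7 * card D + 2 * card V' + sum wt X' \<le> 2 * card V + sum wt X"
      "\<And>T. hits T L' \<Longrightarrow> hits T X' \<Longrightarrow> hits (T \<union> D) (L \<union> X)"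
      using elimination_step[OF less.prems(1,3) u] by metis
    have fin: "finite V'" using step(1) less.prems(1) by (meson finite_subset psubsetE)
    have "card V' < card V" using step(1) less.prems(1) by (simp add: psubset_card_mono)
    then obtain T where T: "T \<subseteq> V'" "hits T (L' \<union> X')" "7 * card T \<le> 2 * card V' + sum wt X'"
      using less.hyps[OF _ fin _ step(2)] dirac_subset[OF less.prems(2)] step(1) by blast
    have "hits T L'" "hits T X'" using T(2) by (auto simp: hits_def)
    then have "hits (T \<union> D) (L \<union> X)" by (rule step(5))
    moreover have "card (T \<union> D) \<le> card T + card D" by (rule card_Un_le)
    moreover have "T \<union> D \<subseteq> V" using T(1) step(1,3) by auto
    ultimately show ?thesis using T(3) step(4) by (intro exI[of _ "T \<union> D"]) simp
  qed
qed

text \<open>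
  Eliminating only vertices outside the closed neighbourhood of \<open>p\<close> never puts \<open>p\<close> into a demand,
  so \<open>p\<close> is discarded for free at the end; this gains the additional unit.
\<close>

lemma weighted_transversal_rooted:
  assumes "finite V" "dirac E V" "demands E V L X"
    and "p \<in> V" "clique (closed_nbhd E V p) E" "p \<notin> \<Union>X"
  shows "\<exists>T\<subseteq>V. hits T (L \<union> X) \<and> 7 * card T + 1 \<le> 2 * card V + sum wt X"
  using assms
proof (induction "card V" arbitrary: V L X rule: less_induct)
  case less
  note p = less.prems(4-6)
  show ?case
  proof (cases "V \<subseteq> closed_nbhd E V p")
    case False
    then obtain u where u: "u \<in> V" "u \<notin> closed_nbhd E V p" "clique (closed_nbhd E V u) E"
      using less.prems(2)[unfolded dirac_def, rule_format, OF subset_refl p(1)] by auto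
    obtain V' L' X' D where step: "V' \<subset> V" "V - V' \<subseteq> insert u (\<Union>X)" "demands E V' L' X'"
      "\<Union>X' \<subseteq> \<Union>X \<union> closed_nbhd E V u" "D \<subseteq> V"
      "7 * card D + 2 * card V' + sum wt X' \<le> 2 * card V + sum wt X"
      "\<And>T. hits T L' \<Longrightarrow> hits T X' \<Longrightarrow> hits (T \<union> D) (L \<union> X)"
      using elimination_step[OF less.prems(1,3) u(1,3)] by metis
    have fin: "finite V'" using step(1) less.prems(1) by (meson finite_subset psubsetE)
    have lt: "card V' < card V" using step(1) less.prems(1) by (simp add: psubset_card_mono)
    have "p \<noteq> u" using u(2) p(1) by (auto simp: closed_nbhd_def)
    then have "p \<in> V'" using p(1,3) step(2) by auto
    moreover have "clique (closed_nbhd E V' p) E" by (rule simplicial_subset[OF p(2)]) (use step(1) in auto)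
    moreover have "p \<notin> closed_nbhd E V u" using u(1,2) \<open>p \<noteq> u\<close> by (auto simp: closed_nbhd_def insert_commute)
    then have "p \<notin> \<Union>X'" using p(3) step(4) by auto
    moreover have "dirac E V'" using dirac_subset[OF less.prems(2)] step(1) by auto
    ultimately obtain T where T: "T \<subseteq> V'" "hits T (L' \<union> X')"
      "7 * card T + 1 \<le> 2 * card V' + sum wt X'"
      using less.hyps[OF lt fin _ step(3)] by auto
    have "hits T L'" "hits T X'" using T(2) by (auto simp: hits_def)
    then have "hits (T \<union> D) (L \<union> X)" by (rule step(7))
    moreover have "card (T \<union> D) \<le> card T + card D" by (rule card_Un_le)
    moreover have "T \<union> D \<subseteq> V" using T(1) step(1,5) by auto
    ultimately show ?thesis using T(3) step(6) by (intro exI[of _ "T \<union> D"]) simp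
  next
    case True
    then have "clique_of V E V" using p(2) clique_mono[of "closed_nbhd E V p" E V] by (simp add: clique_of_def)
    then have L: "K = V" "4 \<le> card V" if "K \<in> L" for K
      using that less.prems(3) unfolding demands_def maximal_clique_def clique_of_def by auto
    show ?thesis
    proof (cases "X = {}")
      case True
      show ?thesis
      proof (cases "L = {}")
        case True
        have "0 < card V" using p(1) less.prems(1) by (auto simp: card_gt_0_iff)
        then show ?thesis using True \<open>X = {}\<close> by (intro exI[of _ "{}"]) (simp add: hits_def)
      next
        case False
        then have "4 \<le> card V" using L(2) by auto
        moreover have "hits {p} L" using L(1) p(1) by (auto simp: hits_def)
        \<comment> \<open>The bound reads 7 + 1 <= 2 * 4 when \<open>V\<close> is a four-clique and
          is tight there.\<close>
        ultimately show ?thesis using True p(1) by (intro exI[of _ "{p}"]) simp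
      qed
    next
      case False
      have X: "\<And>A. A \<in> X \<Longrightarrow> A \<subseteq> V" using less.prems(3) unfolding demands_def by auto
      \<comment> \<open>Now \<open>V\<close> is a clique and the only possible member of
        \<open>L\<close>. Hitting any demand hits it too, so \<open>p\<close> is dropped and its 2
        units cover the additional one.\<close>
      have "demands E (V - {p}) {} X"
        using less.prems(3) p(3) X unfolding demands_def by auto
      then obtain T where T: "T \<subseteq> V - {p}" "hits T ({} \<union> X)" "7 * card T \<le> 2 * card (V - {p}) + sum wt X"
        using weighted_transversal[of "V - {p}" E "{}" X] less.prems(1) dirac_subset[OF less.prems(2)]
        by auto
      obtain A where A: "A \<in> X" using False by auto
      then have "T \<inter> V \<noteq> {}" using T(2) X[OF A] by (auto simp: hits_def)
      then have "hits T (L \<union> X)" using T(2) L(1) by (auto simp: hits_def)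
      moreover have "card V = Suc (card (V - {p}))" using p(1) less.prems(1) by (metis card.remove)
      ultimately show ?thesis using T by (intro exI[of _ T]) auto
    qed
  qed
qed

section \<open>Splitting along a maximal triangle\<close>

text \<open>A piece is given by its vertex set alone; the edge set stays \<open>E\<close>, since
  \<open>clique_of\<close> already confines cliques to \<open>W\<close>.\<close>

definition solves :: "'a set set \<Rightarrow> 'a set \<Rightarrow> 'a set set \<Rightarrow> 'a set \<Rightarrow> bool" where
  "solves E W X T \<longleftrightarrow> clique_transversal W E T \<and> hits T X"

text \<open>The covering half of 4-chordality relative to \<open>W\<close>. It need not pass to
  arbitrary subsets, but it passes to the pieces of a triangle split.\<close>

definition four_covered :: "'a set set \<Rightarrow> 'a set \<Rightarrow> bool" where
  "four_covered E W \<longleftrightarrow> (\<forall>a\<in>W. \<forall>b\<in>W. a \<noteq> b \<and> {a, b} \<in> E \<longrightarrow>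
     (\<exists>K\<subseteq>W. clique K E \<and> card K = 4 \<and> a \<in> K \<and> b \<in> K))"

text \<open>
  In a chordal graph no component of the complement of a maximal triangle sees all three corners; \<open>Px\<close>
  consists of the corners other than \<open>x\<close> and of components that do not see \<open>x\<close>.
\<close>

definition triangle_split ::
    "'a set set \<Rightarrow> 'a set \<Rightarrow> 'a \<Rightarrow> 'a \<Rightarrow> 'a \<Rightarrow> 'a set \<Rightarrow> 'a set \<Rightarrow> 'a set \<Rightarrow> bool" where
  "triangle_split E W x y z Px Py Pz \<longleftrightarrow>
     maximal_clique W E {x, y, z} \<and> x \<noteq> y \<and> y \<noteq> z \<and> x \<noteq> z \<and> W = Px \<union> Py \<union> Pz \<and>
     Py \<inter> Pz = {x} \<and> Px \<inter> Pz = {y} \<and> Px \<inter> Py = {z} \<and>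
     (\<forall>a\<in>W. \<forall>b\<in>W. {a, b} \<in> E \<longrightarrow> {a, b} \<subseteq> Px \<or> {a, b} \<subseteq> Py \<or> {a, b} \<subseteq> Pz)"

lemma triangle_split_rotate:
  assumes "triangle_split E W x y z Px Py Pz"
  shows "triangle_split E W y z x Py Pz Px"
proof -
  have eq: "{y, z, x} = {x, y, z}" by auto
  have S: "maximal_clique W E {x, y, z}" "x \<noteq> y" "y \<noteq> z" "x \<noteq> z" "W = Px \<union> Py \<union> Pz"
    "Py \<inter> Pz = {x}" "Px \<inter> Pz = {y}" "Px \<inter> Py = {z}"
    and edge: "\<And>a b. a \<in> W \<Longrightarrow> b \<in> W \<Longrightarrow> {a, b} \<in> E \<Longrightarrow>
      {a, b} \<subseteq> Px \<or> {a, b} \<subseteq> Py \<or> {a, b} \<subseteq> Pz"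
    using assms unfolding triangle_split_def by auto
  show ?thesis unfolding triangle_split_def eq
  proof (intro conjI ballI impI)
    fix a b assume "a \<in> W" "b \<in> W" "{a, b} \<in> E"
    then show "{a, b} \<subseteq> Py \<or> {a, b} \<subseteq> Pz \<or> {a, b} \<subseteq> Px" using edge[of a b] by auto
  qed (use S in \<open>auto simp: Int_commute\<close>)
qed

lemma triangle_split_corners:
  assumes "triangle_split E W x y z Px Py Pz"
  shows "x \<notin> Px" "y \<notin> Py" "z \<notin> Pz" "y \<in> Px" "z \<in> Px" "x \<in> Py" "z \<in> Py" "x \<in> Pz" "y \<in> Pz"
    "{x, y} \<in> E" "{y, z} \<in> E" "{z, x} \<in> E"
proof -
  have S: "Py \<inter> Pz = {x}" "Px \<inter> Pz = {y}" "Px \<inter> Py = {z}" "x \<noteq> y" "y \<noteq> z" "x \<noteq> z" "clique {x, y, z} E"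
    using assms unfolding triangle_split_def maximal_clique_def clique_of_def by auto
  have "x \<in> Py \<inter> Pz" "y \<in> Px \<inter> Pz" "z \<in> Px \<inter> Py" unfolding S(1-3) by simp_all
  then show mem: "y \<in> Px" "z \<in> Px" "x \<in> Py" "z \<in> Py" "x \<in> Pz" "y \<in> Pz" by simp_all
  show "x \<notin> Px" "y \<notin> Py" "z \<notin> Pz"
    using S(4-6) mem S(1)[THEN equalityD1] S(2)[THEN equalityD1] S(3)[THEN equalityD1] by fast+
  show "{x, y} \<in> E" "{y, z} \<in> E" "{z, x} \<in> E" using S(4-7) by (simp_all add: clique_def)
qed

lemma triangle_split_edge:
  assumes "triangle_split E W x y z Px Py Pz" "{a, b} \<in> E" "a \<in> W" "b \<in> W"
  shows "{a, b} \<subseteq> Px \<or> {a, b} \<subseteq> Py \<or> {a, b} \<subseteq> Pz"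
  using assms unfolding triangle_split_def by simp

text \<open>A vertex that is not a corner lies in exactly one piece, and its edges keep any clique
  through it in that piece. Proper subsets of the triangle fit into a piece anyway.\<close>

lemma clique_in_piece:
  assumes split: "triangle_split E W x y z Px Py Pz" and K: "clique K E" "K \<subseteq> W"
  shows "K = {x, y, z} \<or> K \<subseteq> Px \<or> K \<subseteq> Py \<or> K \<subseteq> Pz"
proof -
  have inter: "Py \<inter> Pz = {x}" "Px \<inter> Pz = {y}" "Px \<inter> Py = {z}" and W: "W = Px \<union> Py \<union> Pz"
    and edge: "\<And>a b. a \<in> W \<Longrightarrow> b \<in> W \<Longrightarrow> {a, b} \<in> E \<Longrightarrow>
      {a, b} \<subseteq> Px \<or> {a, b} \<subseteq> Py \<or> {a, b} \<subseteq> Pz"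
    using split unfolding triangle_split_def by auto
  have pair: "{c, b} \<subseteq> Px \<or> {c, b} \<subseteq> Py \<or> {c, b} \<subseteq> Pz" if "c \<in> K" "b \<in> K" for c b
  proof (cases "c = b")
    case True
    then show ?thesis using that K(2) W by auto
  next
    case False
    then have "{c, b} \<in> E" using that K(1) by (simp add: clique_def)
    then show ?thesis using edge[of c b] that K(2) by auto
  qed
  show ?thesis
  proof (cases "K \<subseteq> {x, y, z}")
    case True
    then show ?thesis using inter by blast
  next
    case False
    then obtain c where c: "c \<in> K" "c \<notin> {x, y, z}" by auto
    then consider "c \<in> Px" "c \<notin> Py" "c \<notin> Pz" | "c \<notin> Px" "c \<in> Py" "c \<notin> Pz" | "c \<notin> Px" "c \<notin> Py" "c \<in> Pz"
      using inter pair[of c c] by auto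
    then show ?thesis using pair[OF c(1)] by cases auto
  qed
qed

text \<open>The other two pieces meet \<open>Px\<close> in a single vertex each, so a four-clique
  through two vertices of \<open>Px\<close> can only lie in \<open>Px\<close>.\<close>

lemma four_covered_piece:
  assumes split: "triangle_split E W x y z Px Py Pz" and cov: "four_covered E W"
  shows "four_covered E Px"
  unfolding four_covered_def
proof (intro ballI impI, elim conjE)
  fix a b assume ab: "a \<in> Px" "b \<in> Px" "a \<noteq> b" "{a, b} \<in> E"
  have W: "W = Px \<union> Py \<union> Pz" and inter: "Px \<inter> Pz = {y}" "Px \<inter> Py = {z}"
    and ne: "x \<noteq> y" "y \<noteq> z" "x \<noteq> z"
    using split unfolding triangle_split_def by auto
  obtain K where K: "K \<subseteq> W" "clique K E" "card K = 4" "a \<in> K" "b \<in> K"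
    using cov ab W unfolding four_covered_def by blast
  have "K \<noteq> {x, y, z}" using K(3) ne by auto
  moreover have "\<not> K \<subseteq> P" if "Px \<inter> P = {c}" for P c
  proof
    assume "K \<subseteq> P"
    then have "a \<in> Px \<inter> P" "b \<in> Px \<inter> P" using ab(1,2) K(4,5) by auto
    then show False using that ab(3) by simp
  qed
  ultimately have "K \<subseteq> Px" using clique_in_piece[OF split K(2,1)] inter by metis
  then show "\<exists>K\<subseteq>Px. clique K E \<and> card K = 4 \<and> a \<in> K \<and> b \<in> K" using K by blast
qed

text \<open>A maximal clique of \<open>W\<close> inside a piece is maximal there, so only the
  triangle needs separate care. \<open>U\<close> may exceed the union of the three solutions so that
  a corner can be added.\<close>

lemma solves_split:
  assumes split: "triangle_split E W x y z Px Py Pz"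
    and T: "solves E Px X1 T1" "solves E Py X2 T2" "solves E Pz X3 T3"
    and U: "T1 \<union> T2 \<union> T3 \<subseteq> U" "U \<subseteq> W" "U \<inter> {x, y, z} \<noteq> {}"
  shows "solves E W (X1 \<union> X2 \<union> X3) U"
proof -
  have W: "W = Px \<union> Py \<union> Pz" using split unfolding triangle_split_def by auto
  have "U \<inter> K \<noteq> {}" if K: "maximal_clique W E K" "2 \<le> card K" for K
  proof -
    have "clique K E" "K \<subseteq> W" using K(1) by (auto simp: maximal_clique_def clique_of_def)
    then consider "K = {x, y, z}" | "K \<subseteq> Px" | "K \<subseteq> Py" | "K \<subseteq> Pz"
      using clique_in_piece[OF split] by blast
    then show ?thesis
    proof cases
      case 2
      then have "maximal_clique Px E K" using maximal_clique_subset[OF K(1)] W by blast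
      then have "T1 \<inter> K \<noteq> {}" using T(1) K(2) by (auto simp: solves_def clique_transversal_def)
      then show ?thesis using U by auto
    next
      case 3
      then have "maximal_clique Py E K" using maximal_clique_subset[OF K(1)] W by blast
      then have "T2 \<inter> K \<noteq> {}" using T(2) K(2) by (auto simp: solves_def clique_transversal_def)
      then show ?thesis using U by auto
    next
      case 4
      then have "maximal_clique Pz E K" using maximal_clique_subset[OF K(1)] W by blast
      then have "T3 \<inter> K \<noteq> {}" using T(3) K(2) by (auto simp: solves_def clique_transversal_def)
      then show ?thesis using U by auto
    qed (use U in simp)
  qed
  moreover have "hits U (X1 \<union> X2 \<union> X3)"
    using T U(1) unfolding solves_def hits_def by fast
  ultimately show ?thesis using U(2) by (auto simp: solves_def clique_transversal_def)
qed

text \<open>By maximality some vertex outside the triangle misses a corner \<open>k\<close>, so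
  there is a simplicial \<open>u\<close> not adjacent to \<open>k\<close>. Delete \<open>u\<close>
  and split the rest: the neighbours of \<open>u\<close> form a clique without \<open>k\<close>,
  hence lie in one piece, which \<open>u\<close> can join.\<close>

lemma triangle_split_exists:
  assumes "finite W" "dirac E W" "maximal_clique W E {x, y, z}" "x \<noteq> y" "y \<noteq> z" "x \<noteq> z"
  shows "\<exists>Px Py Pz. triangle_split E W x y z Px Py Pz"
  using assms(1-3)
proof (induction "card W" arbitrary: W rule: less_induct)
  case less
  have xyz: "clique {x, y, z} E" "{x, y, z} \<subseteq> W"
    using less.prems(3) by (auto simp: maximal_clique_def clique_of_def)
  show ?case
  proof (cases "W = {x, y, z}")
    case True
    then have "triangle_split E W x y z {y, z} {z, x} {x, y}"
      using less.prems(3) assms(4-6) unfolding triangle_split_def by auto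
    then show ?thesis by blast
  next
    case False
    then obtain w where w: "w \<in> W" "w \<notin> {x, y, z}" using xyz(2) by blast
    have "\<exists>k\<in>{x, y, z}. w \<notin> closed_nbhd E W k"
    proof (rule ccontr)
      assume "\<not> ?thesis"
      then have "\<forall>k\<in>{x, y, z}. {w, k} \<in> E" using w by (auto simp: closed_nbhd_def insert_commute)
      then have "clique (insert w {x, y, z}) E"
        using xyz(1) by (auto simp: clique_def insert_commute)
      then have "clique_of W E (insert w {x, y, z})" using xyz(2) w(1) by (simp add: clique_of_def)
      then have "insert w {x, y, z} = {x, y, z}"
        using less.prems(3) unfolding maximal_clique_def by (metis subset_insertI)
      then show False using w(2) by auto
    qed
    then obtain k where k: "k \<in> {x, y, z}" "\<not> W \<subseteq> closed_nbhd E W k" using w(1) by blast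
    then obtain u where u: "u \<in> W" "u \<notin> closed_nbhd E W k" "clique (closed_nbhd E W u) E"
      using less.prems(2)[unfolded dirac_def, rule_format, OF subset_refl, of k] xyz(2) by blast
    have "{x, y, z} \<subseteq> closed_nbhd E W k" using xyz k(1) by (intro clique_subset_closed_nbhd)
    then have uK: "u \<notin> {x, y, z}" using u(2) by blast
    have "card (W - {u}) < card W" using u(1) less.prems(1) by (rule card_Diff1_less[rotated])
    moreover have "maximal_clique (W - {u}) E {x, y, z}"
      by (rule maximal_clique_subset[OF less.prems(3)]) (use uK xyz(2) in auto)
    ultimately obtain Px Py Pz where split: "triangle_split E (W - {u}) x y z Px Py Pz"
      using less.hyps[of "W - {u}"] less.prems(1) dirac_subset[OF less.prems(2)] by blast
    let ?N = "closed_nbhd E W u - {u}"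
    have "clique ?N E" "?N \<subseteq> W - {u}" using clique_mono[OF u(3)] by (auto simp: closed_nbhd_def)
    moreover have "k \<notin> ?N" using u(1,2) by (auto simp: closed_nbhd_def insert_commute)
    ultimately have N: "?N \<subseteq> Px \<or> ?N \<subseteq> Py \<or> ?N \<subseteq> Pz"
      using clique_in_piece[OF split] k(1) by blast
    have nbr: "b \<in> insert u ?N" if "b \<in> W" "{u, b} \<in> E \<or> {b, u} \<in> E" for b
      using that by (auto simp: closed_nbhd_def insert_commute)
    have S: "W - {u} = Px \<union> Py \<union> Pz" "Py \<inter> Pz = {x}" "Px \<inter> Pz = {y}" "Px \<inter> Py = {z}"
      and edge: "\<And>a b. a \<in> W - {u} \<Longrightarrow> b \<in> W - {u} \<Longrightarrow> {a, b} \<in> E \<Longrightarrow>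
        {a, b} \<subseteq> Px \<or> {a, b} \<subseteq> Py \<or> {a, b} \<subseteq> Pz"
      using split unfolding triangle_split_def by auto
    have W: "W = insert u (Px \<union> Py \<union> Pz)" unfolding S(1)[symmetric] using u(1) by auto
    have uP: "u \<notin> Px" "u \<notin> Py" "u \<notin> Pz" using S(1)[THEN equalityD2] by auto
    have new: "triangle_split E W x y z Qx Qy Qz"
      if Q: "Px \<subseteq> Qx" "Py \<subseteq> Qy" "Pz \<subseteq> Qz" "Qx \<union> Qy \<union> Qz = W"
        "Qy \<inter> Qz = {x}" "Qx \<inter> Qz = {y}" "Qx \<inter> Qy = {z}"
        "insert u ?N \<subseteq> Qx \<or> insert u ?N \<subseteq> Qy \<or> insert u ?N \<subseteq> Qz" for Qx Qy Qz
      unfolding triangle_split_def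
    proof (intro conjI ballI impI)
      fix a b assume ab: "a \<in> W" "b \<in> W" "{a, b} \<in> E"
      show "{a, b} \<subseteq> Qx \<or> {a, b} \<subseteq> Qy \<or> {a, b} \<subseteq> Qz"
      proof (cases "a = u \<or> b = u")
        case True
        then have "{a, b} \<subseteq> insert u ?N" using ab nbr[of a] nbr[of b] by auto
        then show ?thesis using Q(8) by blast
      next
        case False
        then have "{a, b} \<subseteq> Px \<or> {a, b} \<subseteq> Py \<or> {a, b} \<subseteq> Pz" using edge[of a b] ab by simp
        then show ?thesis using Q(1-3) by auto
      qed
    qed (use Q less.prems(3) assms(4-6) in auto)
    from N show ?thesis
    proof (elim disjE)
      assume "?N \<subseteq> Px"
      then have "triangle_split E W x y z (insert u Px) Py Pz" by (intro new) (use S W uP in auto)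
      then show ?thesis by blast
    next
      assume "?N \<subseteq> Py"
      then have "triangle_split E W x y z Px (insert u Py) Pz" by (intro new) (use S W uP in auto)
      then show ?thesis by blast
    next
      assume "?N \<subseteq> Pz"
      then have "triangle_split E W x y z Px Py (insert u Pz)" by (intro new) (use S W uP in auto)
      then show ?thesis by blast
    qed
  qed
qed

lemma card_triangle_split:
  assumes "finite W" "triangle_split E W x y z Px Py Pz"
  shows "card W + 3 = card Px + card Py + card Pz" "card Px < card W"
proof -
  have S: "W = Px \<union> Py \<union> Pz" "Py \<inter> Pz = {x}" "Px \<inter> Pz = {y}" "Px \<inter> Py = {z}" "x \<noteq> y"
    using assms(2) by (auto simp: triangle_split_def)
  have fin: "finite Px" "finite Py" "finite Pz" using assms(1) S(1) by auto
  have "(Px \<union> Py) \<inter> Pz = {x, y}" using S by blast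
  then have "card (Px \<union> Py) + card Pz = card W + 2"
    using card_Un_Int[of "Px \<union> Py" Pz] fin S(1,5) by simp
  moreover have "card Px + card Py = card (Px \<union> Py) + 1"
    using card_Un_Int[of Px Py] fin S(4) by simp
  ultimately show "card W + 3 = card Px + card Py + card Pz" by simp
  have "x \<in> W" "x \<notin> Px" using S triangle_split_corners(1)[OF assms(2)] by auto
  then have "Px \<subset> W" using S(1) by auto
  then show "card Px < card W" using assms(1) by (rule psubset_card_mono[rotated])
qed

text \<open>
  The bonuses 3, 5 and 5 are the weights of the demands \<open>{a, b}\<close>, \<open>{a}\<close> and \<open>{b}\<close>.
\<close>

definition good_piece :: "'a set set \<Rightarrow> 'a set \<Rightarrow> 'a set set \<Rightarrow> 'a \<Rightarrow> 'a \<Rightarrow> nat \<Rightarrow> bool" where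
  "good_piece E P X a b M \<longleftrightarrow>
     (\<exists>T. solves E P X T \<and> 7 * card T \<le> M) \<and>
     (\<exists>T. solves E P X T \<and> (a \<in> T \<or> b \<in> T) \<and> 7 * card T \<le> M + 3) \<and>
     (\<exists>T. solves E P X T \<and> a \<in> T \<and> 7 * card T \<le> M + 5) \<and>
     (\<exists>T. solves E P X T \<and> b \<in> T \<and> 7 * card T \<le> M + 5)"

section \<open>Gluing the solutions of three pieces\<close>

lemma solves_subset: "solves E W X T \<Longrightarrow> T \<subseteq> W"
  by (simp add: solves_def clique_transversal_def)

lemma card_Un3_overlap:
  assumes "finite A" "finite B" "finite C" "v \<in> A \<inter> B \<or> v \<in> A \<inter> C \<or> v \<in> B \<inter> C"
  shows "card (A \<union> B \<union> C) + 1 \<le> card A + card B + card C"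
proof -
  have *: "card (A \<union> B \<union> C) + 1 \<le> card A + card B + card C"
    if "finite A" "finite B" "finite C" "v \<in> A \<inter> B" for A B C :: "'a set"
  proof -
    have "1 \<le> card (A \<inter> B)" using that by (metis One_nat_def Suc_leI card_gt_0_iff empty_iff finite_Int)
    then show ?thesis using card_Un_Int[of A B] card_Un_le[of "A \<union> B" C] that by simp
  qed
  show ?thesis
    using assms(4) *[OF assms(1,2,3)] *[OF assms(1,3,2)] *[OF assms(2,3,1)]
    by (auto simp: Un_ac)
qed

text \<open>
  Integrality is what pays for hitting the triangle itself. Relative to \<open>M div 7\<close>, a piece solution
  hitting one of the two corners is free if \<open>M mod 7 \<le> 3\<close>, and one hitting a prescribed corner is free if
  \<open>M mod 7 \<le> 1\<close>; a corner chosen in two pieces saves one vertex.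
\<close>

lemma combine_aux:
  assumes fin: "finite W" and split: "triangle_split E W x y z Px Py Pz"
    and good: "good_piece E Px X1 y z M1" "good_piece E Py X2 z x M2" "good_piece E Pz X3 x y M3"
    and r: "M1 mod 7 + M2 mod 7 + M3 mod 7 \<ge> 12 \<or>
      M1 mod 7 + M2 mod 7 + M3 mod 7 \<ge> 5 \<and> M1 mod 7 \<le> 3 \<or>
      M1 mod 7 \<le> 1 \<and> M2 mod 7 \<le> 1 \<or>
      M1 mod 7 \<le> 1 \<and> M2 mod 7 \<le> 3 \<and> M3 mod 7 \<le> 3"
  shows "\<exists>T. solves E W (X1 \<union> X2 \<union> X3) T \<and> 7 * card T + 5 \<le> M1 + M2 + M3"
proof -
  have W: "W = Px \<union> Py \<union> Pz" using split by (simp add: triangle_split_def)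
  have finT: "finite T" if "solves E P X T" "P \<subseteq> W" for P X T
    using finite_subset[OF solves_subset[OF that(1)]] finite_subset[OF that(2) fin] by blast
  have M: "M = 7 * (M div 7) + M mod 7" for M :: nat by simp
  have union: ?thesis
    if T: "solves E Px X1 T1" "solves E Py X2 T2" "solves E Pz X3 T3"
      and meet: "(T1 \<union> T2 \<union> T3) \<inter> {x, y, z} \<noteq> {}"
      and c: "7 * card (T1 \<union> T2 \<union> T3) + 5 \<le> M1 + M2 + M3" for T1 T2 T3
  proof -
    have "T1 \<union> T2 \<union> T3 \<subseteq> W" using T[THEN solves_subset] W by auto
    then show ?thesis using solves_split[OF split T subset_refl _ meet] c by blast
  qed
  have overlap: ?thesis
    if T: "solves E Px X1 T1" "solves E Py X2 T2" "solves E Pz X3 T3"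
      and v: "v \<in> T1 \<inter> T2 \<or> v \<in> T1 \<inter> T3 \<or> v \<in> T2 \<inter> T3" "v \<in> {x, y, z}"
      and c: "card T1 \<le> M1 div 7" "card T2 \<le> M2 div 7" "card T3 \<le> M3 div 7" for T1 T2 T3 v
  proof (rule union[OF T])
    show "(T1 \<union> T2 \<union> T3) \<inter> {x, y, z} \<noteq> {}" using v by blast
    have "card (T1 \<union> T2 \<union> T3) + 1 \<le> card T1 + card T2 + card T3"
      using v(1) by (intro card_Un3_overlap) (use T finT W in auto)
    then show "7 * card (T1 \<union> T2 \<union> T3) + 5 \<le> M1 + M2 + M3" using c by linarith
  qed
  have b0: "c \<le> M div 7" if "7 * c \<le> M" for c M :: nat using that by linarith
  have b3: "c \<le> M div 7" if "7 * c \<le> M + 3" "M mod 7 \<le> 3" for c M :: nat using that by presburger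
  have b5: "c \<le> M div 7" if "7 * c \<le> M + 5" "M mod 7 \<le> 1" for c M :: nat using that by presburger
  obtain T1 T2 T3 where T0: "solves E Px X1 T1" "solves E Py X2 T2" "solves E Pz X3 T3"
    "7 * card T1 \<le> M1" "7 * card T2 \<le> M2" "7 * card T3 \<le> M3"
    using good unfolding good_piece_def by blast
  note T0b = T0(4-6)[THEN b0]
  obtain U1 U2 U3 where U: "solves E Px X1 U1" "solves E Py X2 U2" "solves E Pz X3 U3"
    "y \<in> U1 \<or> z \<in> U1" "z \<in> U2 \<or> x \<in> U2" "x \<in> U3 \<or> y \<in> U3"
    "7 * card U1 \<le> M1 + 3" "7 * card U2 \<le> M2 + 3" "7 * card U3 \<le> M3 + 3"
    using good unfolding good_piece_def by blast
  obtain Y1 Z1 Z2 where A: "solves E Px X1 Y1" "y \<in> Y1" "7 * card Y1 \<le> M1 + 5"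
    "solves E Px X1 Z1" "z \<in> Z1" "7 * card Z1 \<le> M1 + 5"
    "solves E Py X2 Z2" "z \<in> Z2" "7 * card Z2 \<le> M2 + 5"
    using good unfolding good_piece_def by blast
  from r show ?thesis
  proof (elim disjE conjE)
    \<comment> \<open>Rounding down saves at least 12, and an added corner costs 7.\<close>
    assume s: "M1 mod 7 + M2 mod 7 + M3 mod 7 \<ge> 12"
    let ?U = "insert x (T1 \<union> T2 \<union> T3)"
    have "x \<in> W" using triangle_split_corners[OF split] W by blast
    then have "?U \<subseteq> W" using T0(1-3)[THEN solves_subset] W by auto
    then have "solves E W (X1 \<union> X2 \<union> X3) ?U" by (intro solves_split[OF split T0(1-3)]) auto
    moreover
    have "card ?U \<le> card T1 + card T2 + card T3 + 1"
      using card_Un_le[of "{x}" "T1 \<union> T2 \<union> T3"] card_Un_le[of "T1 \<union> T2" T3] card_Un_le[of T1 T2]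
      by simp
    then have "7 * card ?U + 5 \<le> M1 + M2 + M3"
      using T0b s M[of M1] M[of M2] M[of M3] by linarith
    ultimately show ?thesis by blast
  next
    assume s: "M1 mod 7 + M2 mod 7 + M3 mod 7 \<ge> 5" "M1 mod 7 \<le> 3"
    show ?thesis
    proof (rule union[OF U(1) T0(2,3)])
      show "(U1 \<union> T2 \<union> T3) \<inter> {x, y, z} \<noteq> {}" using U(4) by blast
      have "card (U1 \<union> T2 \<union> T3) \<le> card U1 + card T2 + card T3"
        using card_Un_le[of "U1 \<union> T2" T3] card_Un_le[of U1 T2] by linarith
      then show "7 * card (U1 \<union> T2 \<union> T3) + 5 \<le> M1 + M2 + M3"
        using T0b(2,3) b3[OF U(7) s(2)] s(1) M[of M1] M[of M2] M[of M3] by linarith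
    qed
  next
    \<comment> \<open>Both pieces can afford to choose their common corner \<open>z\<close>, which
      is counted once; this saves 7.\<close>
    assume "M1 mod 7 \<le> 1" "M2 mod 7 \<le> 1"
    then show ?thesis
      using overlap[OF A(4,7) T0(3), of z] A(5,8) b5[OF A(6)] b5[OF A(9)] T0b(3) by simp
  next
    \<comment> \<open>The second and third piece each hit some corner for free. Either they agree on
      \<open>x\<close>, or one of them uses \<open>z\<close> or \<open>y\<close>, and the first
      piece can match that choice.\<close>
    assume s: "M1 mod 7 \<le> 1" "M2 mod 7 \<le> 3" "M3 mod 7 \<le> 3"
    note c = b5[OF A(3) s(1)] b5[OF A(6) s(1)] b3[OF U(8) s(2)] b3[OF U(9) s(3)]
    consider "z \<in> U2" | "y \<in> U3" | "x \<in> U2" "x \<in> U3" using U(5,6) by blast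
    then show ?thesis
    proof cases
      case 1
      then show ?thesis using overlap[OF A(4) U(2,3), of z] A(5) c by simp
    next
      case 2
      then show ?thesis using overlap[OF A(1) U(2,3), of y] A(2) c by simp
    next
      case 3
      then show ?thesis using overlap[OF A(1) U(2,3), of x] c by simp
    qed
  qed
qed

lemma combine:
  assumes fin: "finite W" and split: "triangle_split E W x y z Px Py Pz"
    and good: "good_piece E Px X1 y z M1" "good_piece E Py X2 z x M2" "good_piece E Pz X3 x y M3"
  shows "\<exists>T. solves E W (X1 \<union> X2 \<union> X3) T \<and> 7 * card T + 5 \<le> M1 + M2 + M3"
proof -
  let ?R = "\<lambda>a b c. a + b + c \<ge> 12 \<or> a + b + c \<ge> 5 \<and> a \<le> 3 \<or> a \<le> 1 \<and> b \<le> 1 \<or> a \<le> 1 \<and> b \<le> 3 \<and> c \<le> (3::nat)"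
  \<comment> \<open>If the sum is at least 5, some remainder is at most 3 or all are at least 4 and
    the sum is at least 12. If the sum is at most 4, either two remainders are at most 1, or they
    are 2, 2, 0 in some order.\<close>
  have "?R a b c \<or> ?R b c a \<or> ?R c a b" for a b c by linarith
  then consider "?R (M1 mod 7) (M2 mod 7) (M3 mod 7)" | "?R (M2 mod 7) (M3 mod 7) (M1 mod 7)"
    | "?R (M3 mod 7) (M1 mod 7) (M2 mod 7)" by blast
  then show ?thesis
  proof cases
    case 1
    then show ?thesis by (rule combine_aux[OF fin split good])
  next
    case 2
    have "X2 \<union> X3 \<union> X1 = X1 \<union> X2 \<union> X3" by auto
    then show ?thesis
      using combine_aux[OF fin triangle_split_rotate[OF split] good(2,3,1) 2] by (simp add: ac_simps)
  next
    case 3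
    have "X3 \<union> X1 \<union> X2 = X1 \<union> X2 \<union> X3" by auto
    then show ?thesis
      using combine_aux[OF fin triangle_split_rotate[OF triangle_split_rotate[OF split]] good(3,1,2) 3]
      by (simp add: ac_simps)
  qed
qed

text \<open>
  The induction splits off the two pieces away from the demands. In the remaining piece the new demands
  on \<open>{x, y}\<close> stay on one side of every triangle provided that piece was chosen smallest.
\<close>

definition undivided :: "'a set set \<Rightarrow> 'a set \<Rightarrow> 'a set set \<Rightarrow> bool" where
  "undivided E W X \<longleftrightarrow> (\<forall>x y z Px Py Pz. triangle_split E W x y z Px Py Pz \<longrightarrow>
     \<Union>X \<subseteq> Px \<or> \<Union>X \<subseteq> Py \<or> \<Union>X \<subseteq> Pz)"

lemma edge_undivided:
  assumes "{a, b} \<in> E" "a \<in> W" "b \<in> W" "\<Union>X \<subseteq> {a, b}"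
  shows "undivided E W X"
  unfolding undivided_def
proof (intro allI impI)
  fix x y z Px Py Pz assume "triangle_split E W x y z Px Py Pz"
  then have "{a, b} \<subseteq> Px \<or> {a, b} \<subseteq> Py \<or> {a, b} \<subseteq> Pz"
    using triangle_split_edge assms(1-3) by metis
  then show "\<Union>X \<subseteq> Px \<or> \<Union>X \<subseteq> Py \<or> \<Union>X \<subseteq> Pz" using assms(4) by (meson subset_trans)
qed

text \<open>\<open>Px\<close> and \<open>Py\<close> hang on \<open>Pz\<close> only at
  \<open>y\<close> and \<open>x\<close>, so they can be attached to the side containing both. The
  inner triangle stays maximal: a clique containing it has three vertices in \<open>Pz\<close>,
  hence is neither inside \<open>Px\<close> or \<open>Py\<close> nor equal to the outer
  triangle.\<close>

lemma triangle_split_extend: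
  assumes outer: "triangle_split E W x y z Px Py Pz"
    and inner: "triangle_split E Pz a b c Wa Wb Wc" and xy: "x \<in> Wc" "y \<in> Wc"
  shows "triangle_split E W a b c Wa Wb (Wc \<union> Px \<union> Py)"
proof -
  have O: "W = Px \<union> Py \<union> Pz" "Py \<inter> Pz = {x}" "Px \<inter> Pz = {y}" "x \<noteq> y"
    and Oe: "\<And>u v. u \<in> W \<Longrightarrow> v \<in> W \<Longrightarrow> {u, v} \<in> E \<Longrightarrow>
      {u, v} \<subseteq> Px \<or> {u, v} \<subseteq> Py \<or> {u, v} \<subseteq> Pz"
    using outer unfolding triangle_split_def by auto
  have I: "maximal_clique Pz E {a, b, c}" "a \<noteq> b" "b \<noteq> c" "a \<noteq> c" "Pz = Wa \<union> Wb \<union> Wc"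
    "Wb \<inter> Wc = {a}" "Wa \<inter> Wc = {b}" "Wa \<inter> Wb = {c}"
    and Ie: "\<And>u v. u \<in> Pz \<Longrightarrow> v \<in> Pz \<Longrightarrow> {u, v} \<in> E \<Longrightarrow>
      {u, v} \<subseteq> Wa \<or> {u, v} \<subseteq> Wb \<or> {u, v} \<subseteq> Wc"
    using inner unfolding triangle_split_def by auto
  have abc: "clique {a, b, c} E" "{a, b, c} \<subseteq> Pz"
    using I(1) by (auto simp: maximal_clique_def clique_of_def)
  have zP: "z \<notin> Pz" using triangle_split_corners[OF outer] by simp
  have "maximal_clique W E {a, b, c}" unfolding maximal_clique_def
  proof (intro conjI allI impI)
    show "clique_of W E {a, b, c}" using abc O(1) by (auto simp: clique_of_def)
    fix K assume K: "clique_of W E K" "{a, b, c} \<subseteq> K"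
    then have "K = {x, y, z} \<or> K \<subseteq> Px \<or> K \<subseteq> Py \<or> K \<subseteq> Pz"
      using clique_in_piece[OF outer] by (simp add: clique_of_def)
    moreover have "\<not> K \<subseteq> Px"
    proof
      assume "K \<subseteq> Px"
      then have "{a, b} \<subseteq> Px \<inter> Pz" using K(2) abc(2) by auto
      then show False using O(3) I(2) by auto
    qed
    moreover have "\<not> K \<subseteq> Py"
    proof
      assume "K \<subseteq> Py"
      then have "{a, b} \<subseteq> Py \<inter> Pz" using K(2) abc(2) by auto
      then show False using O(2) I(2) by auto
    qed
    moreover have "K \<noteq> {x, y, z}"
    proof
      assume "K = {x, y, z}"
      then have "{a, b, c} \<subseteq> {x, y}" using K(2) abc(2) zP by auto
      then have "card {a, b, c} \<le> card {x, y}" by (intro card_mono) auto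
      then show False using I(2-4) O(4) by simp
    qed
    ultimately have "K \<subseteq> Pz" by blast
    then show "K = {a, b, c}" using I(1) K unfolding maximal_clique_def clique_of_def by blast
  qed
  moreover have "Wb \<inter> (Wc \<union> Px \<union> Py) = {a}"
  proof -
    have "Wb \<inter> (Px \<union> Py) \<subseteq> Wb \<inter> {x, y}" using O(2,3) I(5) by blast
    also have "\<dots> \<subseteq> Wb \<inter> Wc" using xy by auto
    finally show ?thesis using I(6) by blast
  qed
  moreover have "Wa \<inter> (Wc \<union> Px \<union> Py) = {b}"
  proof -
    have "Wa \<inter> (Px \<union> Py) \<subseteq> Wa \<inter> {x, y}" using O(2,3) I(5) by blast
    also have "\<dots> \<subseteq> Wa \<inter> Wc" using xy by auto
    finally show ?thesis using I(7) by blast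
  qed
  moreover have "{u, v} \<subseteq> Wa \<or> {u, v} \<subseteq> Wb \<or> {u, v} \<subseteq> Wc \<union> Px \<union> Py"
    if "u \<in> W" "v \<in> W" "{u, v} \<in> E" for u v
    using Oe[OF that] Ie[of u v] that(3) by auto
  moreover have "W = Wa \<union> Wb \<union> (Wc \<union> Px \<union> Py)" using O(1) I(5) by auto
  ultimately show ?thesis using I(2-4,8) unfolding triangle_split_def by blast
qed

text \<open>A split of \<open>Pz\<close> keeps the edge \<open>{x, y}\<close> on one side and
  therefore extends to \<open>W\<close>, where the old demands lie on one side as well. The two
  unextended sides are smaller than \<open>Pz\<close>, so minimality puts the old demands on the
  side of \<open>x\<close> and \<open>y\<close>.\<close>

lemma undivided_minimal_piece:
  assumes fin: "finite W" and outer: "triangle_split E W x y z Px Py Pz"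
    and und: "undivided E W X" and X: "\<Union>X \<subseteq> Pz" and Y: "\<Union>Y \<subseteq> \<Union>X \<union> {x, y}"
    and min: "\<And>a b c Wa Wb Wc. triangle_split E W a b c Wa Wb Wc \<Longrightarrow> \<Union>X \<subseteq> Wc \<Longrightarrow> card Pz \<le> card Wc"
  shows "undivided E Pz Y"
  unfolding undivided_def
proof (intro allI impI)
  have finP: "finite Pz" using fin outer by (auto simp: triangle_split_def)
  have O: "Py \<inter> Pz = {x}" "Px \<inter> Pz = {y}" using outer unfolding triangle_split_def by auto
  have main: "\<Union>Y \<subseteq> Wc" if inner: "triangle_split E Pz a b c Wa Wb Wc" and xy: "{x, y} \<subseteq> Wc" for a b c Wa Wb Wc
  proof -
    have I: "Pz = Wa \<union> Wb \<union> Wc" using inner unfolding triangle_split_def by auto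
    have ext: "triangle_split E W a b c Wa Wb (Wc \<union> Px \<union> Py)"
      using triangle_split_extend[OF outer inner] xy by simp
    have "\<not> \<Union>X \<subseteq> Wa"
    proof
      assume "\<Union>X \<subseteq> Wa"
      then have "card Pz \<le> card Wa" by (rule min[OF triangle_split_rotate[OF ext]])
      then show False using card_triangle_split(2)[OF finP inner] by simp
    qed
    moreover have "\<not> \<Union>X \<subseteq> Wb"
    proof
      assume "\<Union>X \<subseteq> Wb"
      then have "card Pz \<le> card Wb" by (rule min[OF triangle_split_rotate[OF triangle_split_rotate[OF ext]]])
      then show False using card_triangle_split(2)[OF finP triangle_split_rotate[OF inner]] by simp
    qed
    ultimately have "\<Union>X \<subseteq> Wc \<union> Px \<union> Py" using und ext unfolding undivided_def by blast
    then have "\<Union>X \<subseteq> Wc \<union> (Px \<inter> Pz) \<union> (Py \<inter> Pz)" using X by auto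
    then have "\<Union>X \<union> {x, y} \<subseteq> Wc" using O xy by (simp add: insert_absorb)
    with Y show ?thesis by (rule subset_trans)
  qed
  fix a b c Wa Wb Wc assume inner: "triangle_split E Pz a b c Wa Wb Wc"
  consider "{x, y} \<subseteq> Wa" | "{x, y} \<subseteq> Wb" | "{x, y} \<subseteq> Wc"
    using triangle_split_edge[OF inner] triangle_split_corners[OF outer] by metis
  then show "\<Union>Y \<subseteq> Wa \<or> \<Union>Y \<subseteq> Wb \<or> \<Union>Y \<subseteq> Wc"
  proof cases
    case 1
    then show ?thesis using main[OF triangle_split_rotate[OF inner]] by simp
  next
    case 2
    then show ?thesis using main[OF triangle_split_rotate[OF triangle_split_rotate[OF inner]]] by simp
  next
    case 3
    then show ?thesis using main[OF inner] by simp
  qed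
qed

section \<open>Induction over maximal triangles\<close>

definition splittable :: "'a set set \<Rightarrow> 'a set \<Rightarrow> bool" where
  "splittable E W \<longleftrightarrow> (\<exists>x y z Px Py Pz. triangle_split E W x y z Px Py Pz)"

lemma demands_insert:
  assumes "demands E W {} X" "A \<subseteq> W" "clique A E" "card A \<in> {1, 2, 3}"
  shows "demands E W {} (insert A X)"
  using assms by (simp add: demands_def)

lemma sum_wt_insert: "finite X \<Longrightarrow> sum wt (insert A X) \<le> sum wt X + wt A"
  by (cases "A \<in> X") (auto simp: insert_absorb)

text \<open>Hitting a prescribed corner is imposed as one more demand, whose weight is the bonus
  allowed by \<open>good_piece\<close>. The gain \<open>g\<close> will be 1 for pieces without
  demands and 0 for the piece carrying them.\<close>

lemma good_from_tests:
  assumes dem: "demands E P {} X" and ab: "{a, b} \<in> E" "a \<noteq> b" "a \<in> P" "b \<in> P"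
    and solve: "\<And>Y. demands E P {} Y \<Longrightarrow> \<Union>Y \<subseteq> \<Union>X \<union> {a, b} \<Longrightarrow>
      \<exists>T. solves E P Y T \<and> 7 * card T + g \<le> 2 * card P + sum wt Y"
  shows "good_piece E P X a b (2 * card P + sum wt X - g)"
proof -
  have fin: "finite X" using dem by (simp add: demands_def)
  have drop: "solves E P X T" "T \<inter> A \<noteq> {}" if "solves E P (insert A X) T" for A T
    using that by (auto simp: solves_def hits_def)
  have test: "\<exists>T. solves E P (insert A X) T \<and> 7 * card T \<le> 2 * card P + sum wt X - g + wt A"
    if A: "A \<subseteq> {a, b}" "A \<noteq> {}" for A
  proof -
    have "A = {a} \<or> A = {b} \<or> A = {a, b}" using A by auto
    then have "card A \<in> {1, 2, 3}" "clique A E" "A \<subseteq> P"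
      using ab by (auto simp: clique_def insert_commute)
    then have "demands E P {} (insert A X)" using demands_insert[OF dem] by simp
    moreover have "\<Union>(insert A X) \<subseteq> \<Union>X \<union> {a, b}" using A(1) by auto
    ultimately obtain T where "solves E P (insert A X) T" "7 * card T + g \<le> 2 * card P + sum wt (insert A X)"
      using solve by blast
    then show ?thesis using sum_wt_insert[OF fin, of A] by (intro exI[of _ T]) auto
  qed
  show ?thesis unfolding good_piece_def
  proof (intro conjI)
    obtain T where "solves E P X T" "7 * card T + g \<le> 2 * card P + sum wt X"
      using solve[OF dem] by blast
    then show "\<exists>T. solves E P X T \<and> 7 * card T \<le> 2 * card P + sum wt X - g" by (intro exI[of _ T]) simp
    have wts: "wt {a, b} = 3" "wt {a} = 5" "wt {b} = 5" using ab(2) by (simp_all add: wt_def)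
    obtain T where "solves E P (insert {a, b} X) T" "7 * card T \<le> 2 * card P + sum wt X - g + wt {a, b}"
      using test[of "{a, b}"] by auto
    then show "\<exists>T. solves E P X T \<and> (a \<in> T \<or> b \<in> T) \<and> 7 * card T \<le> 2 * card P + sum wt X - g + 3"
      using drop[of "{a, b}" T] wts by (intro exI[of _ T]) auto
    obtain T where "solves E P (insert {a} X) T" "7 * card T \<le> 2 * card P + sum wt X - g + wt {a}"
      using test[of "{a}"] by auto
    then show "\<exists>T. solves E P X T \<and> a \<in> T \<and> 7 * card T \<le> 2 * card P + sum wt X - g + 5"
      using drop[of "{a}" T] wts by (intro exI[of _ T]) auto
    obtain T where "solves E P (insert {b} X) T" "7 * card T \<le> 2 * card P + sum wt X - g + wt {b}"
      using test[of "{b}"] by auto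
    then show "\<exists>T. solves E P X T \<and> b \<in> T \<and> 7 * card T \<le> 2 * card P + sum wt X - g + 5"
      using drop[of "{b}" T] wts by (intro exI[of _ T]) auto
  qed
qed

text \<open>An edge extends to a four-clique, which excludes size two; a maximal triangle would give
  a split.\<close>

lemma large_maximal_cliques:
  assumes fin: "finite W" and dirac: "dirac E W" and cov: "four_covered E W"
    and none: "\<not> splittable E W"
    and K: "maximal_clique W E K" "2 \<le> card K"
  shows "4 \<le> card K"
proof (rule ccontr)
  assume "\<not> 4 \<le> card K"
  then consider "card K = 2" | "card K = 3" using K(2) by linarith
  then show False
  proof cases
    case 1
    then obtain a b where ab: "K = {a, b}" "a \<noteq> b" by (auto simp: card_2_iff)
    then have "a \<in> W" "b \<in> W" "{a, b} \<in> E"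
      using K(1) by (auto simp: maximal_clique_def clique_of_def clique_def)
    then obtain K' where "K' \<subseteq> W" "clique K' E" "card K' = 4" "K \<subseteq> K'"
      using cov ab unfolding four_covered_def by blast
    then show False using K(1) 1 by (auto simp: maximal_clique_def clique_of_def)
  next
    case 2
    then obtain x y z where "K = {x, y, z}" "x \<noteq> y" "y \<noteq> z" "x \<noteq> z" by (auto simp: card_3_iff)
    then obtain Px Py Pz where "triangle_split E W x y z Px Py Pz"
      using triangle_split_exists[OF fin dirac] K(1) by metis
    then have "splittable E W" unfolding splittable_def by (intro exI)
    then show False using none by simp
  qed
qed

lemma solves_without_triangle:
  assumes fin: "finite W" and dirac: "dirac E W" and cov: "four_covered E W"
    and none: "\<not> splittable E W"
    and dem: "demands E W {} X"
  shows "\<exists>T. solves E W X T \<and> 7 * card T \<le> 2 * card W + sum wt X"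
    and "\<lbrakk>{a, b} \<in> E; a \<noteq> b; a \<in> W; b \<in> W; \<Union>X \<subseteq> {a, b}\<rbrakk> \<Longrightarrow>
      \<exists>T. solves E W X T \<and> 7 * card T + 1 \<le> 2 * card W + sum wt X"
proof -
  let ?L = "{K. maximal_clique W E K \<and> 2 \<le> card K}"
  have dem': "demands E W ?L X"
    using dem large_maximal_cliques[OF fin dirac cov none] by (auto simp: demands_def)
  have solves: "solves E W X T" if "T \<subseteq> W" "hits T (?L \<union> X)" for T
    using that by (auto simp: solves_def clique_transversal_def hits_def)
  show "\<exists>T. solves E W X T \<and> 7 * card T \<le> 2 * card W + sum wt X"
    using weighted_transversal[OF fin dirac dem'] solves by blast
  assume ab: "{a, b} \<in> E" "a \<noteq> b" "a \<in> W" "b \<in> W" "\<Union>X \<subseteq> {a, b}"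
  obtain K where "K \<subseteq> W" "card K = 4" using cov ab(1-4) unfolding four_covered_def by blast
  \<comment> \<open>More than two vertices are needed for a simplicial \<open>p\<close> off the
    edge; the covering four-clique provides them.\<close>
  then have "4 \<le> card W" using fin by (metis card_mono)
  then have "W \<noteq> {a, b}" using ab(2) by auto
  then obtain p where "p \<in> W" "clique (closed_nbhd E W p) E" "p \<noteq> a" "p \<noteq> b"
    using dirac_simplicial_avoiding[OF dirac ab(1,3,4)] by blast
  moreover from this have "p \<notin> \<Union>X" using ab(5) by blast
  ultimately show "\<exists>T. solves E W X T \<and> 7 * card T + 1 \<le> 2 * card W + sum wt X"
    using weighted_transversal_rooted[OF fin dirac dem', of p] solves by blast
qed

lemma four_covered_pieces:
  assumes "triangle_split E W x y z Px Py Pz" "four_covered E W"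
  shows "four_covered E Px" "four_covered E Py" "four_covered E Pz"
  using four_covered_piece[OF assms] four_covered_piece[OF triangle_split_rotate[OF assms(1)] assms(2)]
    four_covered_piece[OF triangle_split_rotate[OF triangle_split_rotate[OF assms(1)]] assms(2)] .

text \<open>The splittable case is a hypothesis so that the lemma serves both inside the induction,
  with the induction hypothesis, and after it. Demands within an edge are never divided by a
  split.\<close>

lemma good_edge:
  fixes P :: "'a set"
  assumes fin: "finite P" and dirac: "dirac E P" and cov: "four_covered E P"
    and ab: "{a, b} \<in> E" "a \<noteq> b" "a \<in> P" "b \<in> P"
    and split: "\<And>Y. \<lbrakk>splittable E P; demands E P {} Y; undivided E P Y\<rbrakk> \<Longrightarrow>
      \<exists>T. solves E P Y T \<and> 7 * card T + 1 \<le> 2 * card P + sum wt Y"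
  shows "good_piece E P {} a b (2 * card P - 1)"
proof -
  have "good_piece E P {} a b (2 * card P + sum wt ({} :: 'a set set) - 1)"
  proof (rule good_from_tests[OF _ ab])
    show "demands E P {} {}" by (simp add: demands_def)
    fix Y assume Y: "demands E P {} Y" "\<Union>Y \<subseteq> \<Union>{} \<union> {a, b}"
    have Yab: "\<Union>Y \<subseteq> {a, b}" using Y(2) by simp
    show "\<exists>T. solves E P Y T \<and> 7 * card T + 1 \<le> 2 * card P + sum wt Y"
    proof (cases "splittable E P")
      case True
      show ?thesis by (rule split[OF True Y(1) edge_undivided[OF ab(1,3,4) Yab]])
    next
      case False
      show ?thesis by (rule solves_without_triangle(2)[OF fin dirac cov False Y(1) ab Yab])
    qed
  qed
  then show ?thesis by simp
qed

text \<open>The minimum is taken over all pieces of all splits that contain the demands; rotation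
  brings any piece into third position.\<close>

lemma minimal_triangle_split:
  assumes "splittable E W" "undivided E W X"
  obtains x y z Px Py Pz where "triangle_split E W x y z Px Py Pz" "\<Union>X \<subseteq> Pz"
    "\<forall>a b c Wa Wb Wc. triangle_split E W a b c Wa Wb Wc \<longrightarrow> \<Union>X \<subseteq> Wc \<longrightarrow> card Pz \<le> card Wc"
proof -
  define Q where "Q P \<longleftrightarrow> (\<exists>x y z Px Py. triangle_split E W x y z Px Py P) \<and> \<Union>X \<subseteq> P" for P
  obtain x y z Px Py Pz where t: "triangle_split E W x y z Px Py Pz"
    using assms(1) unfolding splittable_def by blast
  have "\<Union>X \<subseteq> Px \<or> \<Union>X \<subseteq> Py \<or> \<Union>X \<subseteq> Pz" using assms(2) t unfolding undivided_def by simp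
  then have "Q Px \<or> Q Py \<or> Q Pz"
    unfolding Q_def using t triangle_split_rotate[OF t] triangle_split_rotate[OF triangle_split_rotate[OF t]]
    by metis
  then obtain P0 where "Q P0" by blast
  then obtain P where P: "Q P" "\<And>P'. Q P' \<Longrightarrow> card P \<le> card P'"
    using ex_has_least_nat[of Q P0 card] by blast
  then obtain a b c Pa Pb where "triangle_split E W a b c Pa Pb P" "\<Union>X \<subseteq> P" unfolding Q_def by blast
  moreover have "\<forall>a b c Wa Wb Wc. triangle_split E W a b c Wa Wb Wc \<longrightarrow> \<Union>X \<subseteq> Wc \<longrightarrow> card P \<le> card Wc"
  proof (intro allI impI)
    fix a b c Wa Wb Wc assume "triangle_split E W a b c Wa Wb Wc" "\<Union>X \<subseteq> Wc"
    then have "Q Wc" unfolding Q_def by blast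
    then show "card P \<le> card Wc" by (rule P(2))
  qed
  ultimately show ?thesis by (rule that)
qed

lemma card_triangle_split_less:
  assumes "finite W" "triangle_split E W x y z Px Py Pz"
  shows "card Px < card W" "card Py < card W" "card Pz < card W"
  using card_triangle_split(2)[OF assms] card_triangle_split(2)[OF assms(1) triangle_split_rotate[OF assms(2)]]
    card_triangle_split(2)[OF assms(1) triangle_split_rotate[OF triangle_split_rotate[OF assms(2)]]] .

lemma solves_undivided:
  assumes "finite W" "dirac E W" "four_covered E W" "demands E W {} X" "undivided E W X"
  shows "\<exists>T. solves E W X T \<and>
    7 * card T + (if splittable E W then 1 else 0) \<le> 2 * card W + sum wt X"
  using assms
proof (induction "card W" arbitrary: W X rule: less_induct)
  case less
  note fin = less.prems(1) and dirac = less.prems(2) and cov = less.prems(3)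
    and dem = less.prems(4) and und = less.prems(5)
  show ?case
  proof (cases "splittable E W")
    case False
    then show ?thesis using solves_without_triangle(1)[OF fin dirac cov False dem] by simp
  next
    case True
    obtain x y z Px Py Pz where split: "triangle_split E W x y z Px Py Pz" and X: "\<Union>X \<subseteq> Pz"
      and min: "\<forall>a b c Wa Wb Wc. triangle_split E W a b c Wa Wb Wc \<longrightarrow> \<Union>X \<subseteq> Wc \<longrightarrow> card Pz \<le> card Wc"
      by (rule minimal_triangle_split[OF True und])
    have W: "W = Px \<union> Py \<union> Pz" and ne: "x \<noteq> y" "y \<noteq> z" "z \<noteq> x"
      using split by (auto simp: triangle_split_def)
    have sub: "Px \<subseteq> W" "Py \<subseteq> W" "Pz \<subseteq> W" using W by auto
    note finP = sub[THEN finite_subset, OF fin] and diracP = sub[THEN dirac_subset[OF dirac]]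
    note corners = triangle_split_corners[OF split] and covP = four_covered_pieces[OF split cov]
    note lt = card_triangle_split_less[OF fin split]
    have IH: "\<exists>T. solves E P Y T \<and> 7 * card T + 1 \<le> 2 * card P + sum wt Y"
      if "card P < card W" "finite P" "dirac E P" "four_covered E P"
        "splittable E P" "demands E P {} Y" "undivided E P Y" for P Y
      using less.hyps[OF that(1-4,6,7)] that(5) by simp
    have x: "good_piece E Px {} y z (2 * card Px - 1)"
      by (rule good_edge[OF finP(1) diracP(1) covP(1) corners(11) ne(2) corners(4,5)
          IH[OF lt(1) finP(1) diracP(1) covP(1)]])
    have y: "good_piece E Py {} z x (2 * card Py - 1)"
      by (rule good_edge[OF finP(2) diracP(2) covP(2) corners(12) ne(3) corners(7,6)
          IH[OF lt(2) finP(2) diracP(2) covP(2)]])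
    \<comment> \<open>No gain is claimed here: if \<open>Pz\<close> has no further split, its
      demands need not lie in one edge and no root is available.\<close>
    have z: "good_piece E Pz X x y (2 * card Pz + sum wt X - 0)"
    proof (rule good_from_tests[OF _ corners(10) ne(1) corners(8,9)])
      show "demands E Pz {} X" using dem X by (auto simp: demands_def)
      fix Y assume Y: "demands E Pz {} Y" "\<Union>Y \<subseteq> \<Union>X \<union> {x, y}"
      have "undivided E Pz Y" by (rule undivided_minimal_piece[OF fin split und X Y(2) min[rule_format]])
      then obtain T where "solves E Pz Y T"
        "7 * card T + (if splittable E Pz then 1 else 0) \<le> 2 * card Pz + sum wt Y"
        using less.hyps[OF lt(3) finP(3) diracP(3) covP(3) Y(1)] by auto
      then show "\<exists>T. solves E Pz Y T \<and> 7 * card T + 0 \<le> 2 * card Pz + sum wt Y"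
        by (intro exI[of _ T]) auto
    qed
    from combine[OF fin split x y z]
    obtain T where T: "solves E W X T"
      "7 * card T + 5 \<le> (2 * card Px - 1) + (2 * card Py - 1) + (2 * card Pz + sum wt X)" by auto
    \<comment> \<open>Positive sizes make the truncated subtractions of 1 exact.\<close>
    have "0 < card Px" "0 < card Py" using corners finP by (auto simp: card_gt_0_iff)
    then have "7 * card T + 1 \<le> 2 * card W + sum wt X"
      using T(2) card_triangle_split(1)[OF fin split] by linarith
    then show ?thesis using T(1) True by auto
  qed
qed

theorem theorem9:
  fixes V :: "'a set" and E :: "'a set set"
  assumes "simple_graph V E"
    and "four_chordal V E"
    and "\<exists>K. k_clique 3 V E K \<and> maximal_clique V E K"
  shows "\<exists>T. clique_transversal V E T \<and> real (card T) \<le> 2 * (real (card V) - 1) / 7"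
proof -
  have fin: "finite V" using assms(1) by (simp add: simple_graph_def)
  have dirac: "dirac E V"
    using chordal_dirac[OF assms(1)] assms(2) by (simp add: four_chordal_def)
  have cov: "four_covered E V" unfolding four_covered_def
  proof (intro ballI impI, elim conjE)
    fix a b assume "{a, b} \<in> E"
    then obtain K where "k_clique 4 V E K" "{a, b} \<subseteq> K"
      using assms(2) unfolding four_chordal_def by blast
    then show "\<exists>K\<subseteq>V. clique K E \<and> card K = 4 \<and> a \<in> K \<and> b \<in> K"
      by (auto simp: k_clique_def clique_of_def)
  qed
  obtain x y z where "maximal_clique V E {x, y, z}" "x \<noteq> y" "y \<noteq> z" "x \<noteq> z"
    using assms(3) by (auto simp: k_clique_def card_3_iff)
  then obtain Px Py Pz where split: "triangle_split E V x y z Px Py Pz"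
    using triangle_split_exists[OF fin dirac] by blast
  have W: "V = Px \<union> Py \<union> Pz" and ne: "x \<noteq> y" "y \<noteq> z" "z \<noteq> x"
    using split by (auto simp: triangle_split_def)
  note corners = triangle_split_corners[OF split]
  have edge: "good_piece E P {} a b (2 * card P - 1)"
    if "P \<subseteq> V" "four_covered E P" "{a, b} \<in> E" "a \<noteq> b" "a \<in> P" "b \<in> P" for P a b
  proof -
    have P: "finite P" "dirac E P" using that(1) finite_subset[OF _ fin] dirac_subset[OF dirac] by auto
    show ?thesis
    proof (rule good_edge[OF P that(2-6)])
      fix Y assume "splittable E P" "demands E P {} Y" "undivided E P Y"
      then show "\<exists>T. solves E P Y T \<and> 7 * card T + 1 \<le> 2 * card P + sum wt Y"
        using solves_undivided[OF P that(2), of Y] by simp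
    qed
  qed
  have sub: "Px \<subseteq> V" "Py \<subseteq> V" "Pz \<subseteq> V" using W by auto
  note covP = four_covered_pieces[OF split cov]
  \<comment> \<open>No piece carries demands at this level, so all three contribute the gain of
    1.\<close>
  from combine[OF fin split
      edge[OF sub(1) covP(1) corners(11) ne(2) corners(4,5)]
      edge[OF sub(2) covP(2) corners(12) ne(3) corners(7,6)]
      edge[OF sub(3) covP(3) corners(10) ne(1) corners(8,9)]]
  obtain T where T: "solves E V {} T"
    "7 * card T + 5 \<le> (2 * card Px - 1) + (2 * card Py - 1) + (2 * card Pz - 1)" by auto
  have "0 < card Px" "0 < card Py" "0 < card Pz"
    using corners finite_subset[OF sub(1) fin] finite_subset[OF sub(2) fin] finite_subset[OF sub(3) fin]
    by (auto simp: card_gt_0_iff)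
  then have "7 * card T + 2 \<le> 2 * card V"
    using T(2) card_triangle_split(1)[OF fin split] by linarith
  then have "real (7 * card T + 2) \<le> real (2 * card V)" by (simp only: of_nat_le_iff)
  then have "real (card T) \<le> 2 * (real (card V) - 1) / 7" by simp
  then show ?thesis using T(1) by (auto simp: solves_def)
qed

end
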